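(* Let $a,b\in\mathbb{Q}$ with $b\in\mathbb{Q}^2$ and suppose that $f(x)=x^8+ax^4+b\in\mathbb{Q}[x]$ is irreducible over $\mathbb{Q}$. Then the following algorithm (a nested case distinction, where "else if" means that the preceding conditions at the same level fail) returns $\mathrm{Gal}(f)$. (1) If $\sqrt{b}\in\mathbb{Q}^2$, then: (a) if $a+2\sqrt{b}\in\mathbb{Q}^2$, return 8T3; (b) else if $a-2\sqrt{b}\in\mathbb{Q}^2$, return 8T4; (c) else if $4b-a^2\in\mathbb{Q}^2$, return 8T2; (d) otherwise, return 8T9. (2) Else (if $\sqrt{b}\notin\mathbb{Q}^2$): (a) If $a+2\sqrt{b}\in\mathbb{Q}^2$, then: (i) if $2b-a\sqrt{b}\in\mathbb{Q}^2$, return 8T4; (ii) else if $-(2b-a\sqrt{b})\in\mathbb{Q}^2$, return 8T2; (iii) otherwise, return 8T9. (b) Else if $a-2\sqrt{b}\in\mathbb{Q}^2$, then: (i) if $2b+a\sqrt{b}\in\mathbb{Q}^2$, return 8T4; (ii) else if $-(2b+a\sqrt{b})\in\mathbb{Q}^2$, return 8T2; (iii) otherwise, return 8T9. (c) Else (if $a+2\sqrt{b}\notin\mathbb{Q}^2$ and $a-2\sqrt{b}\notin\mathbb{Q}^2$): (i) if $2b-a\sqrt{b}\in\mathbb{Q}^2$ and $2b+a\sqrt{b}\in\mathbb{Q}^2$, return 8T4; (ii) else if either $2b-a\sqrt{b}\in\mathbb{Q}^2$ or $2b+a\sqrt{b}\in\mathbb{Q}^2$, return 8T9; (iii) else if at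 least one of $4b-a^2$, $\sqrt{b}(a^2-4b)$, $\sqrt{b}(4b-a^2)$, $-(2b-a\sqrt{b})$, $-(2b+a\sqrt{b})$ is in $\mathbb{Q}^2$, return 8T11; (iv) otherwise, return 8T22.
   Context: $\mathbb{Q}^2=\{k^2:k\in\mathbb{Q}\}$, and $\sqrt{b}$ is the nonnegative square root of $b$ (rational since $b\in\mathbb{Q}^2$). $\mathrm{Gal}(f)$ is the Galois group over $\mathbb{Q}$ of (the splitting field of) $f$, viewed as a transitive permutation group on the eight roots of $f$, i.e. as a transitive subgroup of $S_8$ up to conjugacy. 8Tj denotes the $j$-th conjugacy class of transitive subgroups of $S_8$ in the Butler–McKay (LMFDB) numbering. The classes used here are identified as follows; each consists of exactly the transitive subgroups of $S_8$ that are isomorphic, as abstract groups, to the indicated group: 8T2: $C_4\times C_2$ (order 8); 8T3: $C_2^3$ (order 8); 8T4: the dihedral group $D_4$ of order 8; 8T9: $C_2\times D_4$ (order 16); 8T11: the central product $C_4\circ D_4$ (order 16); 8T22: the central product $D_4\circ D_4$, i.e. the extraspecial group $2^{1+4}_+$ (order 32). *)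

theory Defs
  imports
    "HOL-Algebra.Sym_Groups"
    "HOL-Algebra.Elementary_Groups"
    "HOL-Algebra.Generated_Fields"
    "HOL-Algebra.Algebraic_Closure_Type"
    "HOL-Computational_Algebra.Nth_Powers"
begin

text \<open>The set \<open>\<rat>\<^sup>2\<close> is rendered by the library predicate \<^const>\<open>is_nth_power\<close> \<open>2\<close> at type
  \<^typ>\<open>rat\<close>. The following root is meaningful only for squares of rationals.\<close>

definition rat_sqrt :: "rat \<Rightarrow> rat" where
  "rat_sqrt q = (THE r. 0 \<le> r \<and> r ^ 2 = q)"

lemma rat_sqrt:
  assumes "is_square q"
  shows "0 \<le> rat_sqrt q" "rat_sqrt q ^ 2 = q"
proof -
  obtain k where k: "q = k ^ 2"
    using assms by (auto elim: is_nth_powerE)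
  have "\<exists>!r. 0 \<le> r \<and> r ^ 2 = q"
  proof (rule ex1I[of _ "\<bar>k\<bar>"])
    show "r = \<bar>k\<bar>" if "0 \<le> r \<and> r ^ 2 = q" for r
      using that k by (metis abs_ge_zero power2_abs power2_eq_iff_nonneg)
  qed (simp add: k)
  from theI'[OF this] show "0 \<le> rat_sqrt q" "rat_sqrt q ^ 2 = q"
    unfolding rat_sqrt_def by auto
qed


section \<open>The Galois group of a rational polynomial as a permutation group\<close>

definition complex_roots :: "rat poly \<Rightarrow> complex set" where
  "complex_roots f = {z. poly (map_poly of_rat f) z = 0}"

definition splitting_field :: "rat poly \<Rightarrow> complex set" where
  "splitting_field f = generate_field ring_of_type_algebra (range of_rat \<union> complex_roots f)"

text \<open>Automorphisms of the splitting field over \<open>\<rat>\<close>, made unique as functions on \<^typ>\<open>complex\<close>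
  by extensionality.\<close>

definition galois_group :: "rat poly \<Rightarrow> (complex \<Rightarrow> complex) set" where
  "galois_group f =
     (let L = splitting_field f; K = ring_of_type_algebra\<lparr>carrier := L\<rparr>
      in {\<sigma> \<in> ring_iso K K \<inter> extensional L. \<forall>q. \<sigma> (of_rat q) = of_rat q})"

text \<open>The action of the Galois group on the eight roots, carried over to \<open>{1..8}\<close> along an
  enumeration \<open>\<rho>\<close> of the roots. Another enumeration gives a conjugate subgroup of \<open>S\<^sub>8\<close>.\<close>

definition galois_perms :: "rat poly \<Rightarrow> (nat \<Rightarrow> complex) \<Rightarrow> (nat \<Rightarrow> nat) set" where
  "galois_perms f \<rho> =
     {p. p permutes {1..8} \<and> (\<exists>\<sigma>\<in>galois_group f. \<forall>i\<in>{1..8}. \<rho> (p i) = \<sigma> (\<rho> i))}"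

text \<open>The Galois group of \<open>f\<close>, as a subgroup of \<open>S\<^sub>8\<close> up to conjugacy, is (in) the conjugacy
  class \<open>T\<close>.\<close>

definition has_galois_class :: "rat poly \<Rightarrow> (nat \<Rightarrow> nat) set set \<Rightarrow> bool" where
  "has_galois_class f T \<longleftrightarrow>
     (\<exists>\<rho>. bij_betw \<rho> {1..8} (complex_roots f) \<and> galois_perms f \<rho> \<in> T)"


section \<open>Some classes of transitive groups of degree eight\<close>

definition transitive8_class :: "('a, 'b) monoid_scheme \<Rightarrow> (nat \<Rightarrow> nat) set set" where
  "transitive8_class G =
     {H. subgroup H (sym_group 8) \<and>
         (\<forall>i\<in>{1..8}. \<forall>j\<in>{1..8}. \<exists>h\<in>H. h i = j) \<and>
         (sym_group 8)\<lparr>carrier := H\<rparr> \<cong> G}"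

text \<open>The dihedral group of order \<open>2n\<close> (infinite for \<open>n = 0\<close>): the pair \<open>(k, e)\<close> stands for the
  map \<open>x \<mapsto> k \<plusminus> x\<close> on \<open>\<int>/n\<close>, with the sign \<open>-\<close> iff \<open>e\<close> holds.\<close>

definition dihedral_group :: "nat \<Rightarrow> (int \<times> bool) monoid" where
  "dihedral_group n =
     \<lparr>carrier = carrier (integer_mod_group n) \<times> UNIV,
      monoid.mult = (\<lambda>(k, e) (l, e'). ((k + (if e then - l else l)) mod int n, e \<noteq> e')),
      one = (0, False)\<rparr>"

lemma group_dihedral_group: "group (dihedral_group n)"
proof (rule groupI)
  let ?D = "dihedral_group n"
  fix x y z
  assume "x \<in> carrier ?D" "y \<in> carrier ?D" "z \<in> carrier ?D"
  obtain k e l e' m e'' where xyz: "x = (k, e)" "y = (l, e')" "z = (m, e'')"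
    by (metis surj_pair)
  show "x \<otimes>\<^bsub>?D\<^esub> y \<otimes>\<^bsub>?D\<^esub> z = x \<otimes>\<^bsub>?D\<^esub> (y \<otimes>\<^bsub>?D\<^esub> z)"
    by (cases e; cases e') (simp_all add: xyz dihedral_group_def mod_simps ac_simps diff_diff_eq
         diff_diff_eq2 diff_add_eq add_diff_eq)
next
  let ?D = "dihedral_group n"
  fix x assume "x \<in> carrier ?D"
  obtain k e where ke: "x = (k, e)" by (cases x)
  let ?y = "((if e then k else - k) mod int n, e)"
  have "?y \<in> carrier ?D"
    by (auto simp: dihedral_group_def carrier_integer_mod_group)
  moreover have "?y \<otimes>\<^bsub>?D\<^esub> x = \<one>\<^bsub>?D\<^esub>"
    by (simp add: dihedral_group_def ke mod_simps)
  ultimately show "\<exists>y\<in>carrier ?D. y \<otimes>\<^bsub>?D\<^esub> x = \<one>\<^bsub>?D\<^esub>" ..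
qed (auto simp: dihedral_group_def carrier_integer_mod_group split: if_splits)

text \<open>The central product of \<open>G\<close> and \<open>H\<close> amalgamating the cyclic central subgroups generated by
  \<open>z\<close> and \<open>w\<close> (elements of the same order) along \<open>z \<mapsto> w\<close>.\<close>

definition central_product ::
    "('a, 'c) monoid_scheme \<Rightarrow> 'a \<Rightarrow> ('b, 'd) monoid_scheme \<Rightarrow> 'b \<Rightarrow> ('a \<times> 'b) set monoid" where
  "central_product G z H w = (G \<times>\<times> H) Mod generate (G \<times>\<times> H) {(z, inv\<^bsub>H\<^esub> w)}"

definition T8_2 :: "(nat \<Rightarrow> nat) set set" where
  "T8_2 = transitive8_class (integer_mod_group 4 \<times>\<times> integer_mod_group 2)"

definition T8_3 :: "(nat \<Rightarrow> nat) set set" where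
  "T8_3 = transitive8_class (integer_mod_group 2 \<times>\<times> integer_mod_group 2 \<times>\<times> integer_mod_group 2)"

definition T8_4 :: "(nat \<Rightarrow> nat) set set" where
  "T8_4 = transitive8_class (dihedral_group 4)"

definition T8_9 :: "(nat \<Rightarrow> nat) set set" where
  "T8_9 = transitive8_class (integer_mod_group 2 \<times>\<times> dihedral_group 4)"

text \<open>In the two central products the amalgamated subgroups have order 2; the centre of
  \<open>D\<^sub>4\<close> is generated by the half turn \<open>(2, False)\<close>.\<close>

definition T8_11 :: "(nat \<Rightarrow> nat) set set" where
  "T8_11 = transitive8_class (central_product (integer_mod_group 4) 2 (dihedral_group 4) (2, False))"

definition T8_22 :: "(nat \<Rightarrow> nat) set set" where
  "T8_22 = transitive8_class
     (central_product (dihedral_group 4) (2, False) (dihedral_group 4) (2, False))"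

end

theory Submission
  imports Defs
begin

text \<open>
  Write \<open>s = \<surd>b\<close>, let \<open>\<alpha>\<close> be a root of \<open>f\<close> and \<open>r\<^sup>2 = s\<close>. The roots are \<open>\<plusminus>\<alpha>, \<plusminus>\<i> \<alpha>, \<plusminus>r / \<alpha>, \<plusminus>\<i> r / \<alpha>\<close>, and the
  splitting field is \<open>\<rat>(\<alpha>, \<i>, r)\<close>. An automorphism is therefore described by the root to which it sends \<open>\<alpha>\<close> and by the
  signs with which it acts on \<open>\<i>\<close> and \<open>r\<close>: five bits. These formal descriptions form a group \<open>Gamma\<close> of order 32, an
  extraspecial 2-group whose centre is generated by \<open>\<alpha> \<mapsto> -\<alpha>\<close>, and the Galois group is one of its subgroups.

  The four numbers \<open>\<i>\<close>, \<open>r\<close>, \<open>\<alpha>\<^sup>2 + s / \<alpha>\<^sup>2\<close> and \<open>\<alpha>\<^sup>2 - s / \<alpha>\<^sup>2\<close> are square roots of the rational numbers \<open>-1\<close>,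
  \<open>s\<close>, \<open>2 s - a\<close> and \<open>- (a + 2 s)\<close>. Every formal symmetry multiplies each product of them by a sign, and these signs are
  exactly the characters of \<open>Gamma\<close>. A character is trivial on the Galois group iff the corresponding product of rational
  numbers is a square (\<open>realised_moves_nonsquare\<close>, \<open>realised_fixes_square\<close>). Irreducibility of \<open>f\<close> means transitivity on the roots, and
  transitivity forces the centre into the Galois group (\<open>minus_in_realised\<close>). Modulo the centre everything is a vector space over
  the field with two elements, so by duality the Galois group is the common kernel of the characters whose radicands are
  squares (\<open>realised_eq\<close>).

  It remains to see which sets of radicands can consist of squares. Of the fifteen nontrivial ones, \<open>-1\<close> and \<open>-s\<close>
  are negative and three are excluded by transitivity. The other ten are those tested in the case distinction, and squares are closed under
  products. Together with one sign argument (\<open>sign_obstruction\<close>) this leaves nineteen possibilities, each the kernel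
  of at most two characters. For each of them explicit generators identify the isomorphism type.

  The existence of enough automorphisms needs no general Galois theory. The splitting field is reached from \<open>\<rat>(\<alpha>)\<close>, and
  also from any \<open>\<rat>(\<surd>d)\<close>, by adjoining square roots, and embeddings into the complex numbers extend along square roots
  (\<open>extend_to_square_root\<close>).
\<close>

section \<open>The 32 formal symmetries of the roots\<close>

text \<open>The quintuple \<open>(z, k, e, u, v)\<close> describes the assignment
  \<open>\<alpha> \<mapsto> (-1)\<^sup>z \<i>\<^sup>k \<alpha>\<close> (or \<open>(-1)\<^sup>z \<i>\<^sup>k r / \<alpha>\<close> if \<open>e\<close> holds),
  \<open>\<i> \<mapsto> (-1)\<^sup>u \<i>\<close> and \<open>r \<mapsto> (-1)\<^sup>v r\<close>, where \<open>r\<^sup>4 = b\<close>.\<close>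

type_synonym symmetry = "bool \<times> bool \<times> bool \<times> bool \<times> bool"

text \<open>Composition of such assignments. The last four bits simply add up modulo 2. The first bit receives
  a correction that is bilinear over the field with two elements: applying the first assignment to a factor
  \<open>\<i>\<close> of the second contributes \<open>u \<and> k'\<close>, applying it to \<open>r\<close> contributes \<open>v \<and> e'\<close>, the
  inversion of \<open>\<i>\<^sup>k \<alpha>\<close> contributes \<open>k \<and> e'\<close>, and \<open>\<i> * \<i> = -1\<close> contributes \<open>k \<and> k'\<close>.\<close>

fun gamma_mult :: "symmetry \<Rightarrow> symmetry \<Rightarrow> symmetry" where
  "gamma_mult (z, k, e, u, v) (z', k', e', u', v') =
     ((z \<noteq> z') \<noteq> ((k' \<and> (u \<noteq> k)) \<noteq> (e' \<and> (v \<noteq> k))), k \<noteq> k', e \<noteq> e', u \<noteq> u', v \<noteq> v')"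

definition Gamma :: "symmetry monoid" where
  "Gamma = \<lparr>carrier = UNIV, monoid.mult = gamma_mult, one = (False, False, False, False, False)\<rparr>"

lemma Gamma_simps [simp]:
  "carrier Gamma = UNIV" "monoid.mult Gamma = gamma_mult" "one Gamma = (False, False, False, False, False)"
  by (simp_all add: Gamma_def)

text \<open>Both sides agree because the correction term is bilinear, hence a 2-cocycle.\<close>

lemma gamma_mult_assoc:
  "gamma_mult (gamma_mult (z, k, e, u, v) (z', k', e', u', v')) (z'', k'', e'', u'', v'') =
   gamma_mult (z, k, e, u, v) (gamma_mult (z', k', e', u', v') (z'', k'', e'', u'', v''))"
  by (cases k; cases k'; cases k''; cases u; cases e'; cases e''; simp; blast)

lemma group_Gamma: "group Gamma"
proof (rule groupI)
  show "x \<otimes>\<^bsub>Gamma\<^esub> y \<otimes>\<^bsub>Gamma\<^esub> w = x \<otimes>\<^bsub>Gamma\<^esub> (y \<otimes>\<^bsub>Gamma\<^esub> w)" for x y w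
    by (cases x rule: prod_cases5; cases y rule: prod_cases5; cases w rule: prod_cases5)
       (simp only: Gamma_simps gamma_mult_assoc)
  show "\<exists>y\<in>carrier Gamma. y \<otimes>\<^bsub>Gamma\<^esub> x = \<one>\<^bsub>Gamma\<^esub>" for x
  proof (cases x)
    case (fields z k e u v)
    have "gamma_mult (z \<noteq> ((k \<and> (u \<noteq> k)) \<noteq> (e \<and> (v \<noteq> k))), k, e, u, v) x = \<one>\<^bsub>Gamma\<^esub>"
      by (cases k; cases e) (simp_all add: fields, blast+)
    then show ?thesis by (metis Gamma_simps(1,2) UNIV_I)
  qed
qed auto

section \<open>Homomorphisms out of cyclic and dihedral groups\<close>

context group begin
lemma int_pow_mod:
  assumes "x \<in> carrier G" "x [^] n = \<one>"
  shows "x [^] (m mod int n) = x [^] m"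
proof -
  have "x [^] (int n * (m div int n)) = \<one>"
    using assms by (simp add: int_pow_int flip: int_pow_pow)
  then have "x [^] (int n * (m div int n) + m mod int n) = x [^] (m mod int n)"
    using assms(1) by (simp only: int_pow_mult int_pow_closed l_one)
  then show ?thesis by simp
qed

lemma cyclic_hom:
  assumes "x \<in> carrier G" "x [^] n = \<one>"
  shows "(\<lambda>k::int. x [^] k) \<in> hom (integer_mod_group n) G"
proof (rule homI)
  fix k l :: int
  show "x [^] (k \<otimes>\<^bsub>integer_mod_group n\<^esub> l) = x [^] k \<otimes> x [^] l"
    using assms by (simp add: int_pow_mod int_pow_mult)
qed (use assms in simp)

lemma commute_inv:
  assumes "x \<in> carrier G" "y \<in> carrier G" "x \<otimes> y = y \<otimes> x"
  shows "inv x \<otimes> y = y \<otimes> inv x"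
proof -
  have "inv x \<otimes> y = inv x \<otimes> (y \<otimes> x) \<otimes> inv x" using assms(1,2) by (simp add: m_assoc)
  also have "\<dots> = inv x \<otimes> (x \<otimes> y) \<otimes> inv x" by (simp only: assms(3))
  also have "\<dots> = inv x \<otimes> x \<otimes> y \<otimes> inv x" using assms(1,2) by (simp only: m_assoc m_closed inv_closed)
  finally show ?thesis using assms(1,2) by simp
qed

text \<open>Needed to see that two homomorphisms have commuting images as soon as the images of generators commute.\<close>

lemma commute_int_pow:
  assumes "x \<in> carrier G" "y \<in> carrier G" "x \<otimes> y = y \<otimes> x"
  shows "x [^] (k::int) \<otimes> y = y \<otimes> x [^] k"
proof -
  have pow: "x [^] n \<otimes> y = y \<otimes> x [^] n" for n :: nat
  proof (induction n)
    case (Suc n)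
    have "x [^] Suc n \<otimes> y = x [^] n \<otimes> (y \<otimes> x)"
      using assms(1,2) by (simp only: nat_pow_Suc m_assoc nat_pow_closed assms(3))
    also have "\<dots> = y \<otimes> x [^] n \<otimes> x"
      using assms(1,2) by (simp only: m_assoc nat_pow_closed flip: Suc)
    also have "\<dots> = y \<otimes> x [^] Suc n"
      using assms(1,2) by (simp only: nat_pow_Suc m_assoc nat_pow_closed)
    finally show ?case .
  qed (use assms in simp)
  show ?thesis
    using pow commute_inv[OF _ assms(2) pow] assms(1) by (simp only: int_pow_def2 nat_pow_closed split: if_splits) blast
qed
end

lemma (in group) commute_int_pows:
  assumes "x \<in> carrier G" "y \<in> carrier G" "x \<otimes> y = y \<otimes> x"
  shows "x [^] (k::int) \<otimes> y [^] (l::int) = y [^] l \<otimes> x [^] k"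
  by (rule commute_int_pow[OF _ _ commute_int_pow[symmetric]]) (use assms in \<open>simp_all only: int_pow_closed\<close>)

text \<open>The relations force \<open>t\<close> to invert every power of \<open>r\<close>, which is all that the multiplication table of
  the dihedral group uses.\<close>

lemma (in group) dihedral_hom:
  assumes rt: "r \<in> carrier G" "t \<in> carrier G" 
    and "r [^] n = \<one>" "t \<otimes> t = \<one>" "t \<otimes> r = inv r \<otimes> t"
  shows "(\<lambda>(k::int, e). r [^] k \<otimes> (if e then t else \<one>)) \<in> hom (dihedral_group n) G"
proof (rule homI)
  have swap: "t \<otimes> r [^] k = r [^] (- k) \<otimes> t" for k :: int
  proof -
    have c: "(t \<otimes> r \<otimes> t) = inv r" using assms by (simp add: m_assoc)
    have *: "(t \<otimes> r \<otimes> t) [^] (m::nat) = t \<otimes> r [^] m \<otimes> t" for m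
    proof (induction m)
      case (Suc m)
      have "t \<otimes> r [^] m \<otimes> t \<otimes> (t \<otimes> r \<otimes> t) = t \<otimes> r [^] m \<otimes> (t \<otimes> t) \<otimes> (r \<otimes> t)"
        using rt by (simp add: m_assoc)
      then show ?case using Suc assms by (simp add: m_assoc)
    qed (use assms in simp)
    have **: "t \<otimes> r [^] m = inv (r [^] m) \<otimes> t" for m :: nat
    proof -
      have "inv (r [^] m) \<otimes> t = t \<otimes> r [^] m \<otimes> (t \<otimes> t)"
        using * [of m] rt by (simp add: c nat_pow_inv m_assoc)
      then show ?thesis using assms by simp
    qed
    have "t \<otimes> inv (r [^] m) = r [^] m \<otimes> t" for m :: nat
    proof -
      let ?p = "r [^] m"
      have "t \<otimes> inv ?p = ?p \<otimes> (inv ?p \<otimes> t) \<otimes> inv ?p" using rt by (simp flip: m_assoc)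
      also have "\<dots> = ?p \<otimes> t" using rt by (simp add: m_assoc flip: **)
      finally show ?thesis .
    qed
    with ** show ?thesis using rt by (cases k rule: int_cases2) (simp_all add: int_pow_int int_pow_neg)
  qed
  fix x y assume "x \<in> carrier (dihedral_group n)" "y \<in> carrier (dihedral_group n)"
  obtain k e l e' where xy: "x = (k, e)" "y = (l, e')" by (metis surj_pair)
  note ord = int_pow_mod[OF rt(1) assms(3)]
  have tt: "t \<otimes> (t \<otimes> w) = w" if "w \<in> carrier G" for w
    using that assms by (simp flip: m_assoc)
  show "(\<lambda>(k::int, e). r [^] k \<otimes> (if e then t else \<one>)) (x \<otimes>\<^bsub>dihedral_group n\<^esub> y) =
        (\<lambda>(k::int, e). r [^] k \<otimes> (if e then t else \<one>)) x \<otimes> (\<lambda>(k::int, e). r [^] k \<otimes> (if e then t else \<one>)) y"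
  proof (cases e)
    case True
    have "r [^] k \<otimes> t \<otimes> (r [^] l \<otimes> w) = r [^] (k - l) \<otimes> (t \<otimes> w)" if "w \<in> carrier G" for w
    proof -
      have "r [^] k \<otimes> t \<otimes> (r [^] l \<otimes> w) = r [^] k \<otimes> (t \<otimes> r [^] l) \<otimes> w"
        using rt that by (simp add: m_assoc)
      also have "\<dots> = r [^] k \<otimes> r [^] (- l) \<otimes> (t \<otimes> w)"
        using rt that by (simp add: swap m_assoc)
      finally show ?thesis using rt by (simp flip: int_pow_mult)
    qed
    then show ?thesis using True rt assms(4) by (simp add: xy dihedral_group_def ord)
  next
    case False
    then show ?thesis using rt by (simp add: xy dihedral_group_def ord int_pow_mult m_assoc)
  qed
qed (use rt in \<open>auto\<close>)

lemma (in group) DirProd_hom: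
  assumes "\<phi> \<in> hom A G" "\<psi> \<in> hom B G"
    and "\<And>x y. x \<in> carrier A \<Longrightarrow> y \<in> carrier B \<Longrightarrow> \<phi> x \<otimes> \<psi> y = \<psi> y \<otimes> \<phi> x"
  shows "(\<lambda>(x, y). \<phi> x \<otimes> \<psi> y) \<in> hom (A \<times>\<times> B) G"
proof (rule homI)
  fix p q assume "p \<in> carrier (A \<times>\<times> B)" "q \<in> carrier (A \<times>\<times> B)"
  then obtain x y x' y' where p: "p = (x, y)" "x \<in> carrier A" "y \<in> carrier B"
    and q: "q = (x', y')" "x' \<in> carrier A" "y' \<in> carrier B" by auto
  have c: "\<phi> x \<in> carrier G" "\<phi> x' \<in> carrier G" "\<psi> y \<in> carrier G" "\<psi> y' \<in> carrier G"
    using p q assms(1,2) by (auto intro: hom_in_carrier)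
  have "\<phi> x \<otimes> \<phi> x' \<otimes> (\<psi> y \<otimes> \<psi> y') = \<phi> x \<otimes> (\<phi> x' \<otimes> \<psi> y) \<otimes> \<psi> y'"
    using c by (simp add: m_assoc)
  also have "\<dots> = \<phi> x \<otimes> \<psi> y \<otimes> (\<phi> x' \<otimes> \<psi> y')"
    using c by (simp add: m_assoc assms(3)[OF q(2) p(3)])
  finally show "(\<lambda>(x, y). \<phi> x \<otimes> \<psi> y) (p \<otimes>\<^bsub>A \<times>\<times> B\<^esub> q) = (\<lambda>(x, y). \<phi> x \<otimes> \<psi> y) p \<otimes> (\<lambda>(x, y). \<phi> x \<otimes> \<psi> y) q"
    using p q assms(1,2) by (simp add: hom_mult)
qed (use assms in \<open>auto intro: hom_in_carrier\<close>)

lemma card_Collect_enum: "card {x::'a::enum. P x} = length (filter P Enum.enum)"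
  by (subst distinct_card [symmetric]) (simp_all add: enum_distinct flip: UNIV_enum)

section \<open>Recognising the six groups inside a given group\<close>

lemma carrier_C2: "carrier (integer_mod_group 2) = {0, 1}"
  and carrier_C4: "carrier (integer_mod_group 4) = {0, 1, 2, 3}"
  and carrier_D4: "carrier (dihedral_group 4) = {0, 1, 2, 3} \<times> {False, True}"
  by (auto simp: carrier_integer_mod_group dihedral_group_def)

lemma one_D4: "\<one>\<^bsub>dihedral_group 4\<^esub> = (0, False)"
  and mult_D4: "(k, e) \<otimes>\<^bsub>dihedral_group 4\<^esub> (l, e') = ((k + (if e then - l else l)) mod 4, e \<noteq> e')"
  by (simp_all add: dihedral_group_def)

lemma Gamma_int_pow [simp]:
  "x [^]\<^bsub>Gamma\<^esub> (0::int) = (False, False, False, False, False)"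
  "x [^]\<^bsub>Gamma\<^esub> (1::int) = x"
  "x [^]\<^bsub>Gamma\<^esub> (2::int) = gamma_mult x x"
  "x [^]\<^bsub>Gamma\<^esub> (3::int) = gamma_mult (gamma_mult x x) x"
proof -
  interpret group Gamma by (rule group_Gamma)
  have "x [^]\<^bsub>Gamma\<^esub> (2::nat) = gamma_mult x x" "x [^]\<^bsub>Gamma\<^esub> (3::nat) = gamma_mult (gamma_mult x x) x"
    using l_one[of x] by (simp_all add: numeral_eq_Suc)
  then show "x [^]\<^bsub>Gamma\<^esub> (2::int) = gamma_mult x x" "x [^]\<^bsub>Gamma\<^esub> (3::int) = gamma_mult (gamma_mult x x) x"
    by (metis int_pow_int of_nat_numeral)+
  show "x [^]\<^bsub>Gamma\<^esub> (1::int) = x" by (rule int_pow_1) simp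
qed simp

text \<open>Comparing cardinalities replaces a proof of surjectivity.\<close>

lemma subgroup_iso_of_inj_hom:
  assumes "group G" "group Q" "subgroup H G" "finite H" "\<phi> \<in> hom Q G" "\<phi> ` carrier Q \<subseteq> H"
    and card: "card H = card (carrier Q)"
    and inj: "\<And>x. x \<in> carrier Q \<Longrightarrow> \<phi> x = \<one>\<^bsub>G\<^esub> \<Longrightarrow> x = \<one>\<^bsub>Q\<^esub>"
  shows "G\<lparr>carrier := H\<rparr> \<cong> Q"
proof -
  interpret group_hom Q G \<phi>
    using assms by (simp add: group_hom_def group_hom_axioms_def)
  have inj: "inj_on \<phi> (carrier Q)"
    using inj by (subst inj_on_one_iff) auto
  have "\<phi> ` carrier Q = H"
    using assms card_image[OF inj] by (intro card_subset_eq) auto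
  then have "\<phi> \<in> iso Q (G\<lparr>carrier := H\<rparr>)"
    using inj by (auto simp: iso_def hom_def bij_betw_def)
  then show ?thesis
    using \<open>group Q\<close> group.iso_sym is_isoI by blast
qed

text \<open>The amalgamating subgroup is generated by an involution, so it has order 2 and is the kernel
  of \<open>\<phi>\<close>. By the first isomorphism theorem and Lagrange's theorem the image then has as many elements as \<open>S\<close>.\<close>

lemma subgroup_iso_central_product:
  assumes "group K" "group G" "group H" and zw: "z \<in> carrier G" "w \<in> carrier H"
    and "subgroup S K" "finite S" "\<phi> \<in> hom (G \<times>\<times> H) K" "\<phi> ` carrier (G \<times>\<times> H) \<subseteq> S"
    and card: "2 * card S = card (carrier (G \<times>\<times> H))"
    and ord: "z \<otimes>\<^bsub>G\<^esub> z = \<one>\<^bsub>G\<^esub>" "w \<otimes>\<^bsub>H\<^esub> w = \<one>\<^bsub>H\<^esub>" "z \<noteq> \<one>\<^bsub>G\<^esub>" 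
    and ker: "\<And>x. x \<in> carrier (G \<times>\<times> H) \<Longrightarrow> \<phi> x = \<one>\<^bsub>K\<^esub> \<longleftrightarrow> x = \<one>\<^bsub>G \<times>\<times> H\<^esub> \<or> x = (z, w)"
  shows "K\<lparr>carrier := S\<rparr> \<cong> central_product G z H w"
proof -
  interpret K: group K by fact
  interpret G: group G by fact
  interpret H: group H by fact
  interpret Q: group "G \<times>\<times> H" by (rule DirProd_group) fact+
  interpret SK: group "K\<lparr>carrier := S\<rparr>" using assms by (simp add: K.subgroup_imp_group)
  interpret \<phi>: group_hom "G \<times>\<times> H" "K\<lparr>carrier := S\<rparr>" \<phi>
    using assms(8,9) by unfold_locales (auto simp: hom_def)
  have inv_w: "inv\<^bsub>H\<^esub> w = w" using ord(2) zw by (simp add: H.inv_equality)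
  have "generate (G \<times>\<times> H) {(z, w)} = {\<one>\<^bsub>G \<times>\<times> H\<^esub>, (z, w)}"
  proof
    have "inv\<^bsub>G \<times>\<times> H\<^esub> (z, w) = (z, w)"
      using ord zw by (intro Q.inv_equality) auto
    then have "subgroup {\<one>\<^bsub>G \<times>\<times> H\<^esub>, (z, w)} (G \<times>\<times> H)"
      using ord zw by (intro Q.subgroupI) auto
    then show "generate (G \<times>\<times> H) {(z, w)} \<subseteq> {\<one>\<^bsub>G \<times>\<times> H\<^esub>, (z, w)}"
      by (intro Q.generate_subgroup_incl) auto
  qed (use generate.one[of "G \<times>\<times> H"] in \<open>auto intro: generate.incl\<close>)
  also have "\<dots> = kernel (G \<times>\<times> H) (K\<lparr>carrier := S\<rparr>) \<phi>"
    using ker zw by (auto simp: kernel_def)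
  finally have gen: "central_product G z H w = G \<times>\<times> H Mod kernel (G \<times>\<times> H) (K\<lparr>carrier := S\<rparr>) \<phi>"
    and k: "kernel (G \<times>\<times> H) (K\<lparr>carrier := S\<rparr>) \<phi> = {\<one>\<^bsub>G \<times>\<times> H\<^esub>, (z, w)}"
    using \<open>_ = kernel _ _ _\<close> by (simp_all add: central_product_def inv_w)
  have "card (kernel (G \<times>\<times> H) (K\<lparr>carrier := S\<rparr>) \<phi>) = 2"
    using ord(3) by (simp add: k)
  moreover have "(\<lambda>C. the_elem (\<phi> ` C)) \<in> hom (G \<times>\<times> H Mod kernel (G \<times>\<times> H) (K\<lparr>carrier := S\<rparr>) \<phi>) (K\<lparr>carrier := S\<rparr>)"
     "inj_on (\<lambda>C. the_elem (\<phi> ` C)) (carrier (G \<times>\<times> H Mod kernel (G \<times>\<times> H) (K\<lparr>carrier := S\<rparr>) \<phi>))"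
    by (rule \<phi>.FactGroup_hom \<phi>.FactGroup_inj_on)+
  moreover have "card (rcosets\<^bsub>G \<times>\<times> H\<^esub> (kernel (G \<times>\<times> H) (K\<lparr>carrier := S\<rparr>) \<phi>)) * 2 = 2 * card S"
    using Q.lagrange[OF \<phi>.subgroup_kernel] calculation(1) card by (simp add: Coset.order_def card)
  moreover from calculation have "(\<lambda>C. the_elem (\<phi> ` C)) ` carrier (G \<times>\<times> H Mod kernel (G \<times>\<times> H) (K\<lparr>carrier := S\<rparr>) \<phi>) = S"
    using \<open>finite S\<close> by (intro card_subset_eq) (auto simp: card_image FactGroup_def hom_def)
  ultimately have "(\<lambda>C. the_elem (\<phi> ` C)) \<in> iso (central_product G z H w) (K\<lparr>carrier := S\<rparr>)"
    unfolding iso_def bij_betw_def gen by simp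
  then show ?thesis
    using group.iso_sym[OF normal.factorgroup_is_group[OF \<phi>.normal_kernel]] is_isoI unfolding gen by blast
qed

context group
begin

definition dihedral_map where
  "dihedral_map r t = (\<lambda>(k::int, e). r [^] k \<otimes> (if e then t else \<one>))"

text \<open>The relations of the dihedral group of order 8 without inverses, so that they can be evaluated directly on quintuples.\<close>

definition dihedral_pair where
  "dihedral_pair r t \<longleftrightarrow> r [^] (4::nat) = \<one> \<and> t \<otimes> t = \<one> \<and> t \<otimes> r \<otimes> (t \<otimes> r) = \<one>"

lemma dihedral_map_hom:
  assumes "r \<in> carrier G" "t \<in> carrier G" "dihedral_pair r t"
  shows "dihedral_map r t \<in> hom (dihedral_group 4) G"
  unfolding dihedral_map_def
proof (rule dihedral_hom)
  have "t \<otimes> r \<otimes> t = inv r"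
    using assms by (intro inv_equality [symmetric]) (simp_all add: dihedral_pair_def m_assoc)
  then have "inv r \<otimes> t = t \<otimes> r \<otimes> (t \<otimes> t)"
    using assms(1,2) by (simp only: m_assoc m_closed flip: \<open>_ = inv r\<close>)
  then show "t \<otimes> r = inv r \<otimes> t"
    using assms by (simp add: dihedral_pair_def)
qed (use assms in \<open>simp_all add: dihedral_pair_def\<close>)

lemma dihedral_map_closed:
  assumes "subgroup S G" "r \<in> S" "t \<in> S"
  shows "dihedral_map r t p \<in> S"
  using assms subgroup_int_pow_closed[OF assms(1,2)]
  by (auto simp: dihedral_map_def case_prod_unfold intro: subgroup.m_closed subgroup.one_closed)

lemma dihedral_map_commute:
  assumes "r \<in> carrier G" "t \<in> carrier G" "x \<in> carrier G" "x \<otimes> r = r \<otimes> x" "x \<otimes> t = t \<otimes> x"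
  shows "x \<otimes> dihedral_map r t p = dihedral_map r t p \<otimes> x"
proof (cases p)
  case (Pair k e)
  have r: "x \<otimes> r [^] k = r [^] k \<otimes> x"
    by (intro commute_int_pow[symmetric] assms(1,3) assms(4)[symmetric])
  have "x \<otimes> (r [^] k \<otimes> t) = r [^] k \<otimes> x \<otimes> t"
    using assms(1-3) by (simp only: r int_pow_closed flip: m_assoc)
  also have "\<dots> = r [^] k \<otimes> t \<otimes> x"
    using assms by (simp add: m_assoc)
  finally show ?thesis
    using assms(1-3) r by (simp add: Pair dihedral_map_def)
qed

text \<open>In this lemma and the following ones, the relations provide a homomorphism from the target group and
  the last assumption is a finite check that its kernel is the expected one.\<close>

lemma iso_C4_C2:
  assumes S: "subgroup S G" "card S = 8" "r \<in> S" "c \<in> S"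
    and rel: "r [^] (4::nat) = \<one>" "c [^] (2::nat) = \<one>" "r \<otimes> c = c \<otimes> r"
    and inj: "\<And>i j. i \<in> {0, 1, 2, 3} \<Longrightarrow> j \<in> {0, 1} \<Longrightarrow> r [^] (i::int) \<otimes> c [^] (j::int) = \<one> \<Longrightarrow> i = 0 \<and> j = 0"
  shows "G\<lparr>carrier := S\<rparr> \<cong> integer_mod_group 4 \<times>\<times> integer_mod_group 2"
proof (rule subgroup_iso_of_inj_hom)
  have c: "r \<in> carrier G" "c \<in> carrier G" using S subgroup.mem_carrier by fast+
  show "(\<lambda>(i, j). r [^] i \<otimes> c [^] j) \<in> hom (integer_mod_group 4 \<times>\<times> integer_mod_group 2) G"
    by (intro DirProd_hom cyclic_hom commute_int_pows c rel)
  show "(\<lambda>(i, j). r [^] i \<otimes> c [^] j) ` carrier (integer_mod_group 4 \<times>\<times> integer_mod_group 2) \<subseteq> S"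
    using subgroup_int_pow_closed[OF S(1)] S by (auto intro!: subgroup.m_closed)
  show "x = \<one>\<^bsub>integer_mod_group 4 \<times>\<times> integer_mod_group 2\<^esub>"
    if "x \<in> carrier (integer_mod_group 4 \<times>\<times> integer_mod_group 2)" "(\<lambda>(i, j). r [^] i \<otimes> c [^] j) x = \<one>" for x
    using that inj[of "fst x" "snd x"] by (cases x) (auto simp: carrier_C4 carrier_C2)
  show "finite S" using S(2) by (simp add: card_ge_0_finite)
qed (use S in \<open>auto simp: carrier_C4 carrier_C2 DirProd_group\<close>)

lemma iso_C2_C2_C2:
  assumes S: "subgroup S G" "card S = 8" "x \<in> S" "y \<in> S" "w \<in> S"
    and rel: "x [^] (2::nat) = \<one>" "y [^] (2::nat) = \<one>" "w [^] (2::nat) = \<one>"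
      "x \<otimes> y = y \<otimes> x" "x \<otimes> w = w \<otimes> x" "y \<otimes> w = w \<otimes> y"
    and inj: "\<And>i j k. i \<in> {0, 1} \<Longrightarrow> j \<in> {0, 1} \<Longrightarrow> k \<in> {0, 1} \<Longrightarrow> 
       x [^] (i::int) \<otimes> (y [^] (j::int) \<otimes> w [^] (k::int)) = \<one> \<Longrightarrow> i = 0 \<and> j = 0 \<and> k = 0"
  shows "G\<lparr>carrier := S\<rparr> \<cong> integer_mod_group 2 \<times>\<times> integer_mod_group 2 \<times>\<times> integer_mod_group 2"
proof (rule subgroup_iso_of_inj_hom)
  let ?C = "integer_mod_group 2" and ?f = "(\<lambda>(i::int, j). x [^] i \<otimes> (\<lambda>(j::int, k::int). y [^] j \<otimes> w [^] k) j)"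
  have c: "x \<in> carrier G" "y \<in> carrier G" "w \<in> carrier G" using S subgroup.mem_carrier by fast+
  have *: "x [^] i \<otimes> (y [^] j \<otimes> w [^] k) = y [^] j \<otimes> w [^] k \<otimes> x [^] i" for i j k :: int
  proof -
    have *: "x \<otimes> y [^] j = y [^] j \<otimes> x" "x \<otimes> w [^] k = w [^] k \<otimes> x"
      by (intro commute_int_pow[symmetric] c rel(4,5)[symmetric])+
    have "x \<otimes> (y [^] j \<otimes> w [^] k) = y [^] j \<otimes> x \<otimes> w [^] k"
      using c by (simp only: *(1) int_pow_closed flip: m_assoc)
    also have "\<dots> = y [^] j \<otimes> w [^] k \<otimes> x"
      using c by (simp add: m_assoc *(2))
    finally show ?thesis using c by (intro commute_int_pow) auto
  qed
  show "?f \<in> hom (?C \<times>\<times> ?C \<times>\<times> ?C) G"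
    by (intro DirProd_hom cyclic_hom commute_int_pows c rel) (auto simp: *)
  show "?f ` carrier (?C \<times>\<times> ?C \<times>\<times> ?C) \<subseteq> S"
    using subgroup_int_pow_closed[OF S(1)] S by (auto intro!: subgroup.m_closed)
  show "p = \<one>\<^bsub>?C \<times>\<times> ?C \<times>\<times> ?C\<^esub>"
    if "p \<in> carrier (?C \<times>\<times> ?C \<times>\<times> ?C)" "?f p = \<one>" for p
    using that inj[of "fst p" "fst (snd p)" "snd (snd p)"] by (cases p) (auto simp: carrier_C2)
  show "finite S" using S(2) by (simp add: card_ge_0_finite)
qed (use S in \<open>auto simp: carrier_C2 DirProd_group\<close>)

lemma iso_D4:
  assumes S: "subgroup S G" "card S = 8" "r \<in> S" "t \<in> S" and rt: "dihedral_pair r t"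
    and inj: "\<And>i e. i \<in> {0, 1, 2, 3} \<Longrightarrow> dihedral_map r t (i, e) = \<one> \<Longrightarrow> i = 0 \<and> \<not> e"
  shows "G\<lparr>carrier := S\<rparr> \<cong> dihedral_group 4"
proof (rule subgroup_iso_of_inj_hom)
  have c: "r \<in> carrier G" "t \<in> carrier G" using S subgroup.mem_carrier by fast+
  show "dihedral_map r t \<in> hom (dihedral_group 4) G"
    using c rt by (rule dihedral_map_hom)
  show "dihedral_map r t ` carrier (dihedral_group 4) \<subseteq> S"
    using dihedral_map_closed[OF S(1,3,4)] by blast
  show "x = \<one>\<^bsub>dihedral_group 4\<^esub>"
    if "x \<in> carrier (dihedral_group 4)" "dihedral_map r t x = \<one>" for x
    using that inj[of "fst x" "snd x"] by (cases x) (auto simp: carrier_D4 one_D4)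
  show "finite S" using S(2) by (simp add: card_ge_0_finite)
qed (use S in \<open>auto simp: carrier_D4 group_dihedral_group\<close>)

lemma iso_C2_D4:
  assumes S: "subgroup S G" "card S = 16" "c \<in> S" "r \<in> S" "t \<in> S"
    and rel: "c [^] (2::nat) = \<one>" "dihedral_pair r t" "c \<otimes> r = r \<otimes> c" "c \<otimes> t = t \<otimes> c"
    and inj: "\<And>j i e. j \<in> {0, 1} \<Longrightarrow> i \<in> {0, 1, 2, 3} \<Longrightarrow> c [^] (j::int) \<otimes> dihedral_map r t (i, e) = \<one> \<Longrightarrow>
      j = 0 \<and> i = 0 \<and> \<not> e"
  shows "G\<lparr>carrier := S\<rparr> \<cong> integer_mod_group 2 \<times>\<times> dihedral_group 4"
proof (rule subgroup_iso_of_inj_hom)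
  let ?f = "\<lambda>(i, p). c [^] i \<otimes> dihedral_map r t p" and ?Q = "integer_mod_group 2 \<times>\<times> dihedral_group 4"
  have c: "c \<in> carrier G" "r \<in> carrier G" "t \<in> carrier G" using S subgroup.mem_carrier by fast+
  have dc: "dihedral_map r t p \<in> carrier G" for p
    using dihedral_map_closed[OF S(1,4,5)] S(1) subgroup.mem_carrier by fast
  show "?f \<in> hom ?Q G"
    by (intro DirProd_hom cyclic_hom commute_int_pow dihedral_map_hom dihedral_map_commute c dc rel)
  show "?f ` carrier ?Q \<subseteq> S"
    using subgroup_int_pow_closed[OF S(1)] S dihedral_map_closed[OF S(1,4,5)] 
    by (auto intro!: subgroup.m_closed)
  show "x = \<one>\<^bsub>?Q\<^esub>" if "x \<in> carrier ?Q" "?f x = \<one>" for x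
    using that inj[of "fst x" "fst (snd x)" "snd (snd x)"] by (cases x) (auto simp: carrier_D4 carrier_C2 one_D4)
  show "finite S" using S(2) by (simp add: card_ge_0_finite)
qed (use S in \<open>auto simp: carrier_D4 carrier_C2 group_dihedral_group DirProd_group\<close>)

lemma iso_C4_central_D4:
  assumes S: "subgroup S G" "card S = 16" "c \<in> S" "r \<in> S" "t \<in> S"
    and rel: "c [^] (4::nat) = \<one>" "dihedral_pair r t" "c \<otimes> r = r \<otimes> c" "c \<otimes> t = t \<otimes> c"
    and ker: "\<And>j i e. j \<in> {0, 1, 2, 3} \<Longrightarrow> i \<in> {0, 1, 2, 3} \<Longrightarrow> c [^] (j::int) \<otimes> dihedral_map r t (i, e) = \<one> \<longleftrightarrow>
      (j = 0 \<and> i = 0 \<or> j = 2 \<and> i = 2) \<and> \<not> e"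
  shows "G\<lparr>carrier := S\<rparr> \<cong> central_product (integer_mod_group 4) 2 (dihedral_group 4) (2, False)"
proof (rule subgroup_iso_central_product)
  let ?f = "\<lambda>(i, p). c [^] i \<otimes> dihedral_map r t p" and ?Q = "integer_mod_group 4 \<times>\<times> dihedral_group 4"
  have c: "c \<in> carrier G" "r \<in> carrier G" "t \<in> carrier G" using S subgroup.mem_carrier by fast+
  have dc: "dihedral_map r t p \<in> carrier G" for p
    using dihedral_map_closed[OF S(1,4,5)] S(1) subgroup.mem_carrier by fast
  show "?f \<in> hom ?Q G"
    by (intro DirProd_hom cyclic_hom commute_int_pow dihedral_map_hom dihedral_map_commute c dc rel)
  show "?f ` carrier ?Q \<subseteq> S"
    using subgroup_int_pow_closed[OF S(1)] S dihedral_map_closed[OF S(1,4,5)] 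
    by (auto intro!: subgroup.m_closed)
  show "?f x = \<one> \<longleftrightarrow> x = \<one>\<^bsub>?Q\<^esub> \<or> x = (2, 2, False)" if "x \<in> carrier ?Q" for x
    using that ker[of "fst x" "fst (snd x)" "snd (snd x)"] by (cases x) (auto simp: carrier_D4 carrier_C4 one_D4)
  show "finite S" using S(2) by (simp add: card_ge_0_finite)
qed (use S in \<open>auto simp: carrier_D4 carrier_C4 one_D4 mult_D4 group_dihedral_group DirProd_group\<close>)

lemma iso_D4_central_D4:
  assumes S: "subgroup S G" "card S = 32" "q \<in> S" "s \<in> S" "r \<in> S" "t \<in> S"
    and rel: "dihedral_pair q s" "dihedral_pair r t" "q \<otimes> r = r \<otimes> q" "q \<otimes> t = t \<otimes> q" "s \<otimes> r = r \<otimes> s" "s \<otimes> t = t \<otimes> s"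
    and ker: "\<And>j d i e. j \<in> {0, 1, 2, 3} \<Longrightarrow> i \<in> {0, 1, 2, 3} \<Longrightarrow>
      dihedral_map q s (j, d) \<otimes> dihedral_map r t (i, e) = \<one> \<longleftrightarrow> (j = 0 \<and> i = 0 \<or> j = 2 \<and> i = 2) \<and> \<not> d \<and> \<not> e"
  shows "G\<lparr>carrier := S\<rparr> \<cong> central_product (dihedral_group 4) (2, False) (dihedral_group 4) (2, False)"
proof (rule subgroup_iso_central_product)
  let ?f = "\<lambda>(p', p). dihedral_map q s p' \<otimes> dihedral_map r t p" and ?Q = "dihedral_group 4 \<times>\<times> dihedral_group 4"
  have c: "q \<in> carrier G" "s \<in> carrier G" "r \<in> carrier G" "t \<in> carrier G" using S subgroup.mem_carrier by fast+
  have dc: "dihedral_map r t p \<in> carrier G" for p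
    using dihedral_map_closed[OF S(1,5,6)] S(1) subgroup.mem_carrier by fast
  have "dihedral_map q s p' \<otimes> dihedral_map r t p = dihedral_map r t p \<otimes> dihedral_map q s p'" for p p'
    by (intro dihedral_map_commute[symmetric] dihedral_map_commute c dc rel
          dihedral_map_commute[OF c(3,4), symmetric])
  then show "?f \<in> hom ?Q G"
    using c rel by (intro DirProd_hom dihedral_map_hom)
  show "?f ` carrier ?Q \<subseteq> S"
    using dihedral_map_closed[OF S(1,3,4)] dihedral_map_closed[OF S(1,5,6)] S
    by (auto intro!: subgroup.m_closed)
  show "?f x = \<one> \<longleftrightarrow> x = \<one>\<^bsub>?Q\<^esub> \<or> x = ((2, False), (2, False))" if "x \<in> carrier ?Q" for x
    using that ker[of "fst (fst x)" "fst (snd x)" "snd (fst x)" "snd (snd x)"] by (cases x) (auto simp: carrier_D4 one_D4)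
  show "finite S" using S(2) by (simp add: card_ge_0_finite)
qed (use S in \<open>auto simp: carrier_D4 one_D4 mult_D4 group_dihedral_group DirProd_group\<close>)

end

section \<open>Isomorphism types of nineteen groups of formal symmetries\<close>

text \<open>Rules by which the relations, the kernels and the cardinalities are evaluated on quintuples.\<close>

lemmas Gamma_iso_simps = card_Collect_enum enum_prod_def enum_bool_def numeral_eq_Suc group.dihedral_pair_def[OF group_Gamma] group.dihedral_map_def[OF group_Gamma]

context
  fixes S :: "symmetry set"
  assumes S: "subgroup S Gamma"
begin

text \<open>Each subgroup below is the common kernel of at most two characters of \<open>Gamma\<close>. The quintuples in the proofs
  are generators of the subgroup satisfying the relations of the target group; they are found by choosing elements with
  prescribed squares and commutators modulo the centre, where the squaring map is a quadratic form.\<close>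

lemma subgroup_iso_C4_C2:
  shows "S = {(z, k, e, u, v). \<not> v \<and> u = e} \<Longrightarrow> Gamma\<lparr>carrier := S\<rparr> \<cong> integer_mod_group 4 \<times>\<times> integer_mod_group 2"
    and "S = {(z, k, e, u, v). u = (k \<noteq> e) \<and> (u \<noteq> v) = k} \<Longrightarrow> Gamma\<lparr>carrier := S\<rparr> \<cong> integer_mod_group 4 \<times>\<times> integer_mod_group 2"
    and "S = {(z, k, e, u, v). u = k \<and> v = (k \<noteq> e)} \<Longrightarrow> Gamma\<lparr>carrier := S\<rparr> \<cong> integer_mod_group 4 \<times>\<times> integer_mod_group 2"
  subgoal by (rule group.iso_C4_C2[OF group_Gamma S, of "(False, True, False, False, False)" "(False, False, True, True, False)"])
    (auto simp: Gamma_iso_simps split: if_splits)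
  subgoal by (rule group.iso_C4_C2[OF group_Gamma S, of "(False, False, True, True, True)" "(False, True, False, True, False)"])
    (auto simp: Gamma_iso_simps split: if_splits)
  subgoal by (rule group.iso_C4_C2[OF group_Gamma S, of "(False, False, True, False, True)" "(False, True, False, True, True)"])
    (auto simp: Gamma_iso_simps split: if_splits)
  done

lemma subgroup_iso_C2_C2_C2:
  shows "S = {(z, k, e, u, v). \<not> v \<and> u = (k \<noteq> e)} \<Longrightarrow> Gamma\<lparr>carrier := S\<rparr> \<cong> integer_mod_group 2 \<times>\<times> integer_mod_group 2 \<times>\<times> integer_mod_group 2"
  subgoal by (rule group.iso_C2_C2_C2[OF group_Gamma S, of "(True, False, False, False, False)" "(False, False, True, True, False)" "(False, True, False, True, False)"])
    (auto simp: Gamma_iso_simps split: if_splits)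
  done

lemma subgroup_iso_D4:
  shows "S = {(z, k, e, u, v). \<not> v \<and> u = k} \<Longrightarrow> Gamma\<lparr>carrier := S\<rparr> \<cong> dihedral_group 4"
    and "S = {(z, k, e, u, v). u = (k \<noteq> e) \<and> v = k} \<Longrightarrow> Gamma\<lparr>carrier := S\<rparr> \<cong> dihedral_group 4"
    and "S = {(z, k, e, u, v). u = k \<and> (u \<noteq> v) = (k \<noteq> e)} \<Longrightarrow> Gamma\<lparr>carrier := S\<rparr> \<cong> dihedral_group 4"
    and "S = {(z, k, e, u, v). v = k \<and> (u \<noteq> v) = (k \<noteq> e)} \<Longrightarrow> Gamma\<lparr>carrier := S\<rparr> \<cong> dihedral_group 4"
  subgoal by (rule group.iso_D4[OF group_Gamma S, of "(False, True, True, True, False)" "(False, False, True, False, False)"])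
    (auto simp: Gamma_iso_simps split: if_splits)
  subgoal by (rule group.iso_D4[OF group_Gamma S, of "(False, True, True, False, True)" "(False, False, True, True, False)"])
    (auto simp: Gamma_iso_simps split: if_splits)
  subgoal by (rule group.iso_D4[OF group_Gamma S, of "(False, False, True, False, True)" "(False, True, False, True, False)"])
    (auto simp: Gamma_iso_simps split: if_splits)
  subgoal by (rule group.iso_D4[OF group_Gamma S, of "(False, True, False, False, True)" "(False, False, True, True, False)"])
    (auto simp: Gamma_iso_simps split: if_splits)
  done

lemma subgroup_iso_C2_D4:
  shows "S = {(z, k, e, u, v). \<not> v} \<Longrightarrow> Gamma\<lparr>carrier := S\<rparr> \<cong> integer_mod_group 2 \<times>\<times> dihedral_group 4"
    and "S = {(z, k, e, u, v). u = (k \<noteq> e)} \<Longrightarrow> Gamma\<lparr>carrier := S\<rparr> \<cong> integer_mod_group 2 \<times>\<times> dihedral_group 4"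
    and "S = {(z, k, e, u, v). u = k} \<Longrightarrow> Gamma\<lparr>carrier := S\<rparr> \<cong> integer_mod_group 2 \<times>\<times> dihedral_group 4"
    and "S = {(z, k, e, u, v). v = k} \<Longrightarrow> Gamma\<lparr>carrier := S\<rparr> \<cong> integer_mod_group 2 \<times>\<times> dihedral_group 4"
    and "S = {(z, k, e, u, v). (u \<noteq> v) = (k \<noteq> e)} \<Longrightarrow> Gamma\<lparr>carrier := S\<rparr> \<cong> integer_mod_group 2 \<times>\<times> dihedral_group 4"
  subgoal by (rule group.iso_C2_D4[OF group_Gamma S, of "(False, False, True, True, False)" "(False, True, False, False, False)" "(False, False, False, True, False)"])
    (auto simp: Gamma_iso_simps split: if_splits)
  subgoal by (rule group.iso_C2_D4[OF group_Gamma S, of "(False, True, False, True, False)" "(False, False, True, True, True)" "(False, False, False, False, True)"])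
    (auto simp: Gamma_iso_simps split: if_splits)
  subgoal by (rule group.iso_C2_D4[OF group_Gamma S, of "(False, True, False, True, True)" "(False, False, True, False, True)" "(False, False, False, False, True)"])
    (auto simp: Gamma_iso_simps split: if_splits)
  subgoal by (rule group.iso_C2_D4[OF group_Gamma S, of "(False, False, True, False, False)" "(False, True, False, False, True)" "(False, False, False, True, False)"])
    (auto simp: Gamma_iso_simps split: if_splits)
  subgoal by (rule group.iso_C2_D4[OF group_Gamma S, of "(False, True, True, False, False)" "(False, False, True, False, True)" "(False, False, False, True, True)"])
    (auto simp: Gamma_iso_simps split: if_splits)
  done

lemma subgroup_iso_C4_central_D4:
  shows "S = {(z, k, e, u, v). u = e} \<Longrightarrow> Gamma\<lparr>carrier := S\<rparr> \<cong> central_product (integer_mod_group 4) 2 (dihedral_group 4) (2, False)"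
    and "S = {(z, k, e, u, v). v = e} \<Longrightarrow> Gamma\<lparr>carrier := S\<rparr> \<cong> central_product (integer_mod_group 4) 2 (dihedral_group 4) (2, False)"
    and "S = {(z, k, e, u, v). (u \<noteq> v) = e} \<Longrightarrow> Gamma\<lparr>carrier := S\<rparr> \<cong> central_product (integer_mod_group 4) 2 (dihedral_group 4) (2, False)"
    and "S = {(z, k, e, u, v). (u \<noteq> v) = k} \<Longrightarrow> Gamma\<lparr>carrier := S\<rparr> \<cong> central_product (integer_mod_group 4) 2 (dihedral_group 4) (2, False)"
    and "S = {(z, k, e, u, v). v = (k \<noteq> e)} \<Longrightarrow> Gamma\<lparr>carrier := S\<rparr> \<cong> central_product (integer_mod_group 4) 2 (dihedral_group 4) (2, False)"
  subgoal by (rule group.iso_C4_central_D4[OF group_Gamma S, of "(False, True, False, False, False)" "(False, False, True, True, True)" "(False, False, False, False, True)"])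
    (auto simp: Gamma_iso_simps split: if_splits)
  subgoal by (rule group.iso_C4_central_D4[OF group_Gamma S, of "(False, False, True, True, True)" "(False, False, True, False, True)" "(False, True, False, True, False)"])
    (auto simp: Gamma_iso_simps split: if_splits)
  subgoal by (rule group.iso_C4_central_D4[OF group_Gamma S, of "(False, True, True, True, False)" "(False, False, True, False, True)" "(False, False, False, True, True)"])
    (auto simp: Gamma_iso_simps split: if_splits)
  subgoal by (rule group.iso_C4_central_D4[OF group_Gamma S, of "(False, True, True, False, True)" "(False, False, True, True, True)" "(False, False, False, True, True)"])
    (auto simp: Gamma_iso_simps split: if_splits)
  subgoal by (rule group.iso_C4_central_D4[OF group_Gamma S, of "(False, False, True, False, True)" "(False, False, True, True, True)" "(False, True, False, True, True)"])
    (auto simp: Gamma_iso_simps split: if_splits)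
  done

lemma subgroup_iso_D4_central_D4:
  shows "S = {(z, k, e, u, v). True} \<Longrightarrow> Gamma\<lparr>carrier := S\<rparr> \<cong> central_product (dihedral_group 4) (2, False) (dihedral_group 4) (2, False)"
  subgoal by (rule group.iso_D4_central_D4[OF group_Gamma S, of "(False, False, True, False, True)" "(False, False, False, False, True)" "(False, True, False, False, True)" "(False, False, False, True, False)"])
    (auto simp: Gamma_iso_simps split: if_splits)
  done

end

section \<open>Embeddings of subfields of the complex numbers\<close>

text \<open>Subfields are plain sets of complex numbers, so that field operations remain those of the type.\<close>

definition subfield_of_complex :: "complex set \<Rightarrow> bool" where
  "subfield_of_complex K \<longleftrightarrow> 1 \<in> K \<and> (\<forall>x\<in>K. - x \<in> K \<and> inverse x \<in> K) \<and>
     (\<forall>x\<in>K. \<forall>y\<in>K. x + y \<in> K \<and> x * y \<in> K)"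

lemma subfield_closed:
  assumes "subfield_of_complex K"
  shows "1 \<in> K" "x \<in> K \<Longrightarrow> - x \<in> K" "x \<in> K \<Longrightarrow> inverse x \<in> K"
    "x \<in> K \<Longrightarrow> y \<in> K \<Longrightarrow> x + y \<in> K" "x \<in> K \<Longrightarrow> y \<in> K \<Longrightarrow> x * y \<in> K"
    "x \<in> K \<Longrightarrow> y \<in> K \<Longrightarrow> x - y \<in> K" "x \<in> K \<Longrightarrow> y \<in> K \<Longrightarrow> x / y \<in> K"
    "0 \<in> K" "x \<in> K \<Longrightarrow> x ^ n \<in> K"
proof -
  show *: "1 \<in> K" "x \<in> K \<Longrightarrow> - x \<in> K" "x \<in> K \<Longrightarrow> inverse x \<in> K"
    "x \<in> K \<Longrightarrow> y \<in> K \<Longrightarrow> x + y \<in> K" "x \<in> K \<Longrightarrow> y \<in> K \<Longrightarrow> x * y \<in> K" for x y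
    using assms by (auto simp: subfield_of_complex_def)
  show "x \<in> K \<Longrightarrow> y \<in> K \<Longrightarrow> x - y \<in> K" "x \<in> K \<Longrightarrow> y \<in> K \<Longrightarrow> x / y \<in> K"
    using *(4)[of x "- y"] *(2)[of y] *(5)[of x "inverse y"] *(3)[of y] by (auto simp: divide_inverse)
  show "0 \<in> K" using *(4)[OF *(1) *(2)[OF *(1)]] by simp
  show "x \<in> K \<Longrightarrow> x ^ n \<in> K" by (induction n) (auto intro: *)
qed

lemma of_rat_in_subfield:
  assumes "subfield_of_complex K"
  shows "of_rat q \<in> K"
proof -
  note K = subfield_closed[OF assms]
  have nat: "of_nat n \<in> K" for n by (induction n) (auto intro: K)
  have int: "of_int n \<in> K" for n by (cases n) (auto intro!: K nat simp del: of_nat_Suc)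
  show ?thesis by (cases q) (auto simp: of_rat_rat intro!: K int)
qed

definition embedding :: "complex set \<Rightarrow> (complex \<Rightarrow> complex) \<Rightarrow> bool" where
  "embedding K \<phi> \<longleftrightarrow> \<phi> 1 = 1 \<and> (\<forall>x\<in>K. \<forall>y\<in>K. \<phi> (x + y) = \<phi> x + \<phi> y \<and> \<phi> (x * y) = \<phi> x * \<phi> y)"

text \<open>Values outside \<open>K\<close> are irrelevant for embeddings of \<open>K\<close>, which lets restrictions be written without changing the function.\<close>

locale field_embedding =
  fixes K :: "complex set" and \<phi> :: "complex \<Rightarrow> complex"
  assumes K: "subfield_of_complex K" and \<phi>: "embedding K \<phi>"
begin

lemmas closed = subfield_closed[OF K]

lemma one [simp]: "\<phi> 1 = 1"
  and add: "x \<in> K \<Longrightarrow> y \<in> K \<Longrightarrow> \<phi> (x + y) = \<phi> x + \<phi> y"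
  and mult: "x \<in> K \<Longrightarrow> y \<in> K \<Longrightarrow> \<phi> (x * y) = \<phi> x * \<phi> y"
  using \<phi> by (auto simp: embedding_def)

lemma zero [simp]: "\<phi> 0 = 0"
  using add[of 0 0] closed(8) by simp

lemma minus: "x \<in> K \<Longrightarrow> \<phi> (- x) = - \<phi> x"
  using add[of x "- x"] closed(2)[of x] by (simp add: eq_neg_iff_add_eq_0 add.commute)

lemma diff: "x \<in> K \<Longrightarrow> y \<in> K \<Longrightarrow> \<phi> (x - y) = \<phi> x - \<phi> y"
  using add[of x "- y"] minus[of y] closed(2)[of y] by simp

lemma power: "x \<in> K \<Longrightarrow> \<phi> (x ^ n) = \<phi> x ^ n"
  by (induction n) (auto simp: mult closed)

lemma inverse: assumes "x \<in> K" shows "\<phi> (inverse x) = inverse (\<phi> x)"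
proof (cases "x = 0")
  case False
  then have "\<phi> x * \<phi> (inverse x) = 1"
    using mult[OF assms closed(3)[OF assms]] by simp
  then show ?thesis by (simp add: inverse_unique)
qed simp

lemma divide: "x \<in> K \<Longrightarrow> y \<in> K \<Longrightarrow> \<phi> (x / y) = \<phi> x / \<phi> y"
  using closed(3)[of y] by (simp add: divide_inverse mult inverse)

lemma eq_0_iff: assumes "x \<in> K" shows "\<phi> x = 0 \<longleftrightarrow> x = 0"
proof
  assume *: "\<phi> x = 0"
  show "x = 0"
  proof (rule ccontr)
    assume "x \<noteq> 0"
    then have "\<phi> (x * inverse x) = 1" by simp
    then show False using * assms closed(3)[OF assms] by (simp only: mult) simp
  qed
qed simp

lemma inj: "inj_on \<phi> K"
proof (rule inj_onI)
  fix x y assume "x \<in> K" "y \<in> K" "\<phi> x = \<phi> y"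
  then show "x = y" using eq_0_iff[of "x - y"] diff[of x y] closed(6)[of x y] by simp
qed

lemma of_rat [simp]: "\<phi> (of_rat q) = of_rat q"
proof -
  have nat_in: "of_nat n \<in> K" for n using of_rat_in_subfield[OF K, of "of_nat n"] by simp
  have nat: "\<phi> (of_nat n) = of_nat n" for n
    by (induction n) (simp_all add: add closed nat_in)
  have int: "\<phi> (of_int n) = of_int n" for n
    by (cases n) (simp_all add: nat nat_in minus closed del: of_nat_Suc)
  have "of_int n \<in> K" for n using of_rat_in_subfield[OF K, of "of_int n"] by simp
  then show ?thesis by (cases q) (simp add: of_rat_rat divide int)
qed

end

text \<open>An element of \<open>K(\<delta>)\<close> is uniquely \<open>x + y \<delta>\<close> with \<open>x, y \<in> K\<close>, and sending \<open>\<delta>\<close> to a square root of the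
  image of \<open>\<delta>\<^sup>2\<close> respects the product because products only involve \<open>\<delta>\<^sup>2\<close>.\<close>

lemma adjoin_square_root:
  assumes K: "subfield_of_complex K" and \<phi>: "embedding K \<phi>"
    and \<delta>: "\<delta> ^ 2 \<in> K" "\<delta> \<notin> K" and \<delta>': "\<delta>' ^ 2 = \<phi> (\<delta> ^ 2)"
  obtains K' \<phi>' where "subfield_of_complex K'" "embedding K' \<phi>'" "K \<subseteq> K'" "\<delta> \<in> K'"
    "\<And>x. x \<in> K \<Longrightarrow> \<phi>' x = \<phi> x" "\<phi>' \<delta> = \<delta>'"
proof -
  interpret field_embedding K \<phi> using K \<phi> by unfold_locales
  define K' where "K' = {x + y * \<delta> | x y. x \<in> K \<and> y \<in> K}"
  have uniq: "x = x' \<and> y = y'"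
    if "x \<in> K" "y \<in> K" "x' \<in> K" "y' \<in> K" "x + y * \<delta> = x' + y' * \<delta>" for x y x' y'
  proof -
    have "(y - y') * \<delta> = x' - x" using that(5) by (simp add: algebra_simps)
    then have "\<delta> = (x' - x) / (y - y')" if "y \<noteq> y'" using that by (simp add: field_simps)
    moreover have "(x' - x) / (y - y') \<in> K" by (intro closed that)
    ultimately have "y = y'" using \<delta>(2) by metis
    then show ?thesis using that(5) by simp
  qed
  define \<phi>' where "\<phi>' w = (SOME v. \<exists>x\<in>K. \<exists>y\<in>K. w = x + y * \<delta> \<and> v = \<phi> x + \<phi> y * \<delta>')" for w
  have \<phi>': "\<phi>' (x + y * \<delta>) = \<phi> x + \<phi> y * \<delta>'" if "x \<in> K" "y \<in> K" for x y
    unfolding \<phi>'_def using that by (intro some_equality) (auto dest: uniq[rotated 4])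
  have ext: "\<phi>' x = \<phi> x" if "x \<in> K" for x
    using \<phi>'[OF that closed(8)] by simp
  have mult': "(x + y * \<delta>) * (x' + y' * \<delta>) = (x * x' + y * y' * \<delta> ^ 2) + (x * y' + y * x') * \<delta>" for x y x' y'
    by (simp add: algebra_simps power2_eq_square)
  show ?thesis
  proof
    show "K \<subseteq> K'" unfolding K'_def using closed(8) by force
    show "\<delta> \<in> K'" unfolding K'_def using closed(1,8) by force
    show "\<phi>' \<delta> = \<delta>'" using \<phi>'[OF closed(8,1)] by simp
    have "inverse w \<in> K'" if "w \<in> K'" for w
    proof -
      obtain x y where w: "w = x + y * \<delta>" "x \<in> K" "y \<in> K" using \<open>w \<in> K'\<close> by (auto simp: K'_def)
      let ?n = "x ^ 2 - y ^ 2 * \<delta> ^ 2"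
      show ?thesis
      proof (cases "w = 0")
        case False
        \<comment> \<open>The norm of \<open>w\<close>; it is nonzero because \<open>\<delta> \<notin> K\<close>.\<close>
        have n: "?n = w * (x - y * \<delta>)"
          by (simp add: w(1) algebra_simps power2_eq_square)
        have "x - y * \<delta> \<noteq> 0"
          using uniq[of x "- y" 0 0, OF w(2) closed(2)[OF w(3)] closed(8,8)] w(1) False by auto
        then have nz: "?n \<noteq> 0" using n False by (simp only: mult_eq_0_iff) simp
        have "w * ((x - y * \<delta>) / ?n) = ?n / ?n"
          by (simp only: times_divide_eq_right n)
        also have "\<dots> = 1" using nz by (rule divide_self)
        finally have "inverse w = (x - y * \<delta>) / ?n" by (rule inverse_unique)
        then have "inverse w = x / ?n + (- y / ?n) * \<delta>"
          by (simp add: diff_divide_distrib)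
        moreover have "x / ?n \<in> K" "- y / ?n \<in> K"
          by (intro closed w \<delta>(1))+
        ultimately show ?thesis unfolding K'_def by blast
      qed (use \<open>K \<subseteq> K'\<close> closed(8) in auto)
    qed
    moreover have "- w \<in> K'" if "w \<in> K'" for w
    proof -
      obtain x y where w: "w = x + y * \<delta>" "x \<in> K" "y \<in> K" using \<open>w \<in> K'\<close> unfolding K'_def by blast
      then have "- w = - x + (- y) * \<delta>" by simp
      then show ?thesis using closed(2)[OF w(2)] closed(2)[OF w(3)] unfolding K'_def by blast
    qed
    moreover have "w + w' \<in> K' \<and> w * w' \<in> K' \<and> \<phi>' (w + w') = \<phi>' w + \<phi>' w' \<and> \<phi>' (w * w') = \<phi>' w * \<phi>' w'"
      if "w \<in> K'" "w' \<in> K'" for w w'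
    proof -
      obtain x y where w: "w = x + y * \<delta>" "x \<in> K" "y \<in> K" using \<open>w \<in> K'\<close> unfolding K'_def by blast
      obtain x' y' where w': "w' = x' + y' * \<delta>" "x' \<in> K" "y' \<in> K" using \<open>w' \<in> K'\<close> unfolding K'_def by blast
      have s: "w + w' = (x + x') + (y + y') * \<delta>" by (simp add: w w' algebra_simps)
      have p: "w * w' = (x * x' + y * y' * \<delta> ^ 2) + (x * y' + y * x') * \<delta>" by (simp only: w w' mult')
      have pw: "\<phi>' w = \<phi> x + \<phi> y * \<delta>'" "\<phi>' w' = \<phi> x' + \<phi> y' * \<delta>'"
        unfolding w(1) w'(1) using \<phi>' w w' by blast+
      have "\<phi>' (w + w') = \<phi> (x + x') + \<phi> (y + y') * \<delta>'"
        unfolding s by (intro \<phi>' closed w w')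
      then have "\<phi>' (w + w') = \<phi>' w + \<phi>' w'"
        by (simp add: pw add[OF w(2) w'(2)] add[OF w(3) w'(3)] ring_distribs)
      moreover have "\<phi>' (w * w') = \<phi> (x * x' + y * y' * \<delta> ^ 2) + \<phi> (x * y' + y * x') * \<delta>'"
        unfolding p by (intro \<phi>' closed w w' \<delta>(1))
      then have "\<phi>' (w * w') = \<phi>' w * \<phi>' w'"
        using w(2,3) w'(2,3) \<delta>(1)
        by (simp add: pw add mult closed(5) \<delta>'[symmetric] ring_distribs) (simp add: algebra_simps power2_eq_square)
      moreover have "w + w' \<in> K'" unfolding s K'_def using closed(4)[OF w(2) w'(2)] closed(4)[OF w(3) w'(3)] by blast
      moreover have "x * x' + y * y' * \<delta> ^ 2 \<in> K" "x * y' + y * x' \<in> K"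
        by (intro closed w w' \<delta>(1))+
      then have "w * w' \<in> K'" unfolding p K'_def by blast
      ultimately show ?thesis by simp
    qed
    ultimately show "subfield_of_complex K'" "embedding K' \<phi>'"
      using \<open>K \<subseteq> K'\<close> closed(1) ext[OF closed(1)] unfolding subfield_of_complex_def embedding_def by auto
  qed (fact ext)
qed

text \<open>The splitting field is a tower of quadratic extensions over any of the fields from which
  embeddings are constructed below, so this is the only extension theorem needed beyond a simple start.\<close>

lemma extend_to_square_root:
  assumes K: "subfield_of_complex K" and \<phi>: "embedding K \<phi>" and \<delta>: "\<delta> ^ 2 \<in> K"
  obtains K' \<phi>' where "subfield_of_complex K'" "embedding K' \<phi>'" "K \<subseteq> K'" "\<delta> \<in> K'"
    "\<And>x. x \<in> K \<Longrightarrow> \<phi>' x = \<phi> x"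
proof (cases "\<delta> \<in> K")
  case True
  then show ?thesis using that K \<phi> by blast
next
  case False
  show ?thesis
  proof (rule adjoin_square_root[OF K \<phi> \<delta> False])
    show "csqrt (\<phi> (\<delta> ^ 2)) ^ 2 = \<phi> (\<delta> ^ 2)" by simp
  qed (rule that)
qed

lemma extend_to_square_roots:
  assumes "subfield_of_complex K" "embedding K \<phi>"
    and "list_all (\<lambda>\<delta>. \<delta> ^ 2 \<in> K) \<delta>s"
  obtains K' \<phi>' where "subfield_of_complex K'" "embedding K' \<phi>'" "K \<subseteq> K'" "set \<delta>s \<subseteq> K'"
    "\<And>x. x \<in> K \<Longrightarrow> \<phi>' x = \<phi> x"
  using assms
proof (induction \<delta>s arbitrary: K \<phi> thesis)
  case Nil
  then show ?case by simp
next
  case (Cons \<delta> \<delta>s)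
  obtain K1 \<phi>1 where 1: "subfield_of_complex K1" "embedding K1 \<phi>1" "K \<subseteq> K1" "\<delta> \<in> K1"
    "\<And>x. x \<in> K \<Longrightarrow> \<phi>1 x = \<phi> x"
  proof (rule extend_to_square_root[OF Cons.prems(2,3), of \<delta>])
    show "\<delta> ^ 2 \<in> K" using Cons.prems(4) by simp
  qed (rule that)
  have "list_all (\<lambda>\<delta>. \<delta> ^ 2 \<in> K1) \<delta>s" using Cons.prems(4) 1(3) by (auto simp: list_all_iff)
  obtain K2 \<phi>2 where "subfield_of_complex K2" "embedding K2 \<phi>2" "K1 \<subseteq> K2" "set \<delta>s \<subseteq> K2"
    "\<And>x. x \<in> K1 \<Longrightarrow> \<phi>2 x = \<phi>1 x"
    by (rule Cons.IH[OF _ 1(1,2) \<open>list_all _ \<delta>s\<close>]) (rule that)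
  note 2 = this
  show ?case
  proof (rule Cons.prems(1)[of K2 \<phi>2])
    show "\<phi>2 x = \<phi> x" if "x \<in> K" for x
      using 2(5)[of x] 1(5)[OF that] 1(3) that by auto
  qed (use 1 2 in auto)
qed

abbreviation eval_rat :: "rat poly \<Rightarrow> complex \<Rightarrow> complex" where
  "eval_rat p \<equiv> poly (map_poly of_rat p)"

lemma of_rat_poly_hom:
  "map_poly of_rat (p + q) = (map_poly of_rat p + map_poly of_rat q :: 'a::field_char_0 poly)"
  "map_poly of_rat (- p) = (- map_poly of_rat p :: 'a::field_char_0 poly)"
  "map_poly of_rat (p * q) = (map_poly of_rat p * map_poly of_rat q :: 'a::field_char_0 poly)"
  by (intro poly_eqI; simp add: coeff_map_poly coeff_mult of_rat_sum of_rat_add of_rat_mult of_rat_minus)+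

lemma irreducible_bezout:
  fixes f p :: "'a :: field_gcd poly"
  assumes f: "Factorial_Ring.irreducible f" and False: "\<not> f dvd p"
  obtains u v where "u * f + v * p = 1"
proof -
  have "\<not> f dvd gcd f p" using False by simp
  then have "is_unit (gcd f p)"
    using irreducibleD'[OF f, of "gcd f p"] by simp
  then have "gcd f p = 1" by simp
  then show ?thesis using bezout_coefficients_fst_snd[of f p] that by metis
qed

lemma eval_rat_eq_0_iff_dvd:
  assumes f: "Factorial_Ring.irreducible f" and x: "eval_rat f x = 0"
  shows "eval_rat p x = 0 \<longleftrightarrow> f dvd p"
proof
  assume 0: "eval_rat p x = 0"
  show "f dvd p"
  proof (rule ccontr)
    assume "\<not> f dvd p"
    with irreducible_bezout[OF f] obtain u v where "u * f + v * p = 1" by blast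
    then have "eval_rat (u * f + v * p) x = 1" by simp
    then show False using 0 x by (simp add: of_rat_poly_hom)
  qed
qed (use x in \<open>auto simp: of_rat_poly_hom\<close>)

text \<open>The field \<open>\<rat>(\<alpha>)\<close> consists of the values of rational polynomials at \<open>\<alpha>\<close>, and a polynomial vanishes
  at \<open>\<alpha>\<close> iff it vanishes at the conjugate \<open>\<beta>\<close>, since both are roots of the same irreducible polynomial.\<close>

lemma adjoin_root:
  assumes f: "Factorial_Ring.irreducible f" and \<alpha>: "eval_rat f \<alpha> = 0" and \<beta>: "eval_rat f \<beta> = 0"
  obtains K \<phi> where "subfield_of_complex K" "embedding K \<phi>" "\<alpha> \<in> K" "\<phi> \<alpha> = \<beta>"
proof -
  note dvd = eval_rat_eq_0_iff_dvd[OF f]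
  have eq: "eval_rat p \<alpha> = eval_rat q \<alpha> \<longleftrightarrow> eval_rat p \<beta> = eval_rat q \<beta>" for p q
  proof -
    have "eval_rat p x = eval_rat q x \<longleftrightarrow> f dvd (p - q)" if x: "eval_rat f x = 0" for x
    proof -
      have "eval_rat (p - q) x = eval_rat p x - eval_rat q x"
        using of_rat_poly_hom(1)[of "p - q" q, where ?'a = complex] by (simp add: algebra_simps flip: poly_add)
      then show ?thesis using dvd[OF x, of "p - q"] by simp
    qed
    from this[OF \<alpha>] this[OF \<beta>] show ?thesis by simp
  qed
  define K where "K = range (\<lambda>p. eval_rat p \<alpha>)"
  define \<phi> where "\<phi> x = eval_rat (SOME p. x = eval_rat p \<alpha>) \<beta>" for x
  have \<phi>: "\<phi> (eval_rat p \<alpha>) = eval_rat p \<beta>" for p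
    unfolding \<phi>_def by (rule someI2[of _ p]) (simp_all add: eq)
  show ?thesis
  proof
    have X: "map_poly of_rat [:0, 1:] = ([:0, 1:] :: complex poly)" by (simp add: map_poly_pCons)
    show "\<alpha> \<in> K" using rangeI[of "\<lambda>p. eval_rat p \<alpha>" "[:0, 1:]"] by (simp add: K_def X)
    show "\<phi> \<alpha> = \<beta>" using \<phi>[of "[:0, 1:]"] by (simp add: X)
    have "inverse (eval_rat p \<alpha>) \<in> K" for p
    proof (cases "eval_rat p \<alpha> = 0")
      case True
      then show ?thesis using rangeI[of "\<lambda>p. eval_rat p \<alpha>" 0] by (simp add: K_def)
    next
      case False
      then obtain u v where "u * f + v * p = 1" using irreducible_bezout[OF f] dvd[OF \<alpha>] by metis
      then have "eval_rat (u * f + v * p) \<alpha> = 1" by simp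
      then have "eval_rat v \<alpha> * eval_rat p \<alpha> = 1" using \<alpha> by (simp add: of_rat_poly_hom)
      then have "inverse (eval_rat p \<alpha>) = eval_rat v \<alpha>" by (metis inverse_unique mult.commute)
      then show ?thesis by (simp add: K_def)
    qed
    moreover have "- eval_rat p \<alpha> \<in> K" for p
      using rangeI[of "\<lambda>p. eval_rat p \<alpha>" "- p"] by (simp add: K_def of_rat_poly_hom)
    moreover have "eval_rat p \<alpha> + eval_rat q \<alpha> \<in> K \<and> eval_rat p \<alpha> * eval_rat q \<alpha> \<in> K" for p q
      using rangeI[of "\<lambda>p. eval_rat p \<alpha>" "p + q"] rangeI[of "\<lambda>p. eval_rat p \<alpha>" "p * q"] 
      by (simp add: K_def of_rat_poly_hom)
    moreover have "1 \<in> K"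
      using rangeI[of "\<lambda>p. eval_rat p \<alpha>" 1] by (simp add: K_def)
    ultimately show "subfield_of_complex K" by (auto simp: subfield_of_complex_def K_def)
    show "embedding K \<phi>"
      unfolding embedding_def K_def
    proof (intro conjI ballI)
      show "\<phi> 1 = 1" using \<phi>[of 1] by simp
      fix x y assume "x \<in> range (\<lambda>p. eval_rat p \<alpha>)" "y \<in> range (\<lambda>p. eval_rat p \<alpha>)"
      then obtain p q where xy: "x = eval_rat p \<alpha>" "y = eval_rat q \<alpha>" by blast
      show "\<phi> (x + y) = \<phi> x + \<phi> y"
        using \<phi>[of "p + q"] by (simp add: xy \<phi>[of p] \<phi>[of q] of_rat_poly_hom)
      show "\<phi> (x * y) = \<phi> x * \<phi> y"
        using \<phi>[of "p * q"] by (simp add: xy \<phi>[of p] \<phi>[of q] of_rat_poly_hom)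
    qed
  qed
qed

section \<open>Linear functionals over the field with two elements\<close>

text \<open>Vectors over the field with two elements are lists of truth values; addition is exclusive disjunction.\<close>

fun dot2 :: "bool list \<Rightarrow> bool list \<Rightarrow> bool" where
  "dot2 (c # cs) (x # xs) = ((c \<and> x) \<noteq> dot2 cs xs)"
| "dot2 _ _ = False"

abbreviation add2 :: "bool list \<Rightarrow> bool list \<Rightarrow> bool list" where
  "add2 \<equiv> map2 (\<noteq>)"

lemma dot2_add2:
  assumes "length c = length x" "length x = length y"
  shows "dot2 c (add2 x y) = (dot2 c x \<noteq> dot2 c y)"
  using assms by (induction c x y rule: list_induct3) auto

lemma dot2_replicate_False [simp]: "\<not> dot2 (replicate n False) x"
proof (induction n arbitrary: x)
  case (Suc n) then show ?case by (cases x) auto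
qed simp

lemma add2_add2: "length x = length y \<Longrightarrow> add2 (add2 x y) y = x"
  by (induction x y rule: list_induct2) auto

lemma add2_self: "add2 x x = replicate (length x) False"
  by (induction x) auto

text \<open>A subspace is an intersection of hyperplanes. The induction splits off the first coordinate: if some
  vector \<open>t\<close> of \<open>V\<close> has first coordinate 1, then \<open>V\<close> is spanned by it and by the vectors with first coordinate 0,
  and a functional for the latter extends by choosing the coefficient that makes it vanish on \<open>t\<close>.\<close>

lemma separating_functional:
  assumes "V \<noteq> {}" "\<And>x. x \<in> V \<Longrightarrow> length x = n" "\<And>x y. x \<in> V \<Longrightarrow> y \<in> V \<Longrightarrow> add2 x y \<in> V"
    and "length w = n" "w \<notin> V"
  shows "\<exists>c. length c = n \<and> (\<forall>x\<in>V. \<not> dot2 c x) \<and> dot2 c w"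
  using assms
proof (induction n arbitrary: V w)
  case 0
  then show ?case by (metis equals0I length_0_conv)
next
  case (Suc n)
  define V' where "V' = {y. False # y \<in> V}"
  obtain x0 where "x0 \<in> V" using Suc.prems(1) by blast
  then have "replicate (Suc n) False \<in> V"
    using Suc.prems(3)[of x0 x0] Suc.prems(2)[of x0] by (simp only: add2_self)
  then have ne: "V' \<noteq> {}" by (auto simp: V'_def)
  have len: "length y = n" if "y \<in> V'" for y using Suc.prems(2)[of "False # y"] that by (simp add: V'_def)
  have closed: "add2 x y \<in> V'" if "x \<in> V'" "y \<in> V'" for x y
    using Suc.prems(3)[of "False # x" "False # y"] that by (simp add: V'_def)
  have IH: "\<exists>c. length c = n \<and> (\<forall>x\<in>V'. \<not> dot2 c x) \<and> dot2 c y"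
    if "length y = n" "y \<notin> V'" for y
    by (rule Suc.IH[of V', OF ne _ _ that]) (simp_all only: len closed)
  obtain b y where w: "w = b # y" "length y = n" using Suc.prems(4) by (cases w) auto
  show ?case
  proof (cases "\<exists>t. True # t \<in> V")
    case False
    have head: "\<exists>t. x = False # t \<and> t \<in> V'" if "x \<in> V" for x
      using that False Suc.prems(2)[OF that] by (cases x; cases "hd x") (auto simp: V'_def)
    show ?thesis
    proof (cases b)
      case True
      then show ?thesis using head w by (intro exI[of _ "True # replicate n False"]) fastforce
    next
      case b: False
      then have "y \<notin> V'" using Suc.prems(5) w by (simp add: V'_def)
      from IH[OF w(2) this] obtain c where "length c = n" "\<forall>x\<in>V'. \<not> dot2 c x" "dot2 c y" by blast
      then show ?thesis using head w by (intro exI[of _ "False # c"]) fastforce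
    qed
  next
    case True
    then obtain t where t: "True # t \<in> V" by blast
    then have lt: "length t = n" using Suc.prems(2)[of "True # t"] by simp
    \<comment> \<open>Adding \<open>True # t\<close> clears a leading \<open>True\<close> without changing membership in \<open>V\<close>.\<close>
    have shift: "x \<in> V \<longleftrightarrow> (if hd x then add2 (tl x) t else tl x) \<in> V'" if "length x = Suc n" for x
    proof (cases x)
      case (Cons h x')
      show ?thesis
      proof (cases h)
        case True
        have "add2 (add2 x' t) t = x'" using that lt by (intro add2_add2) (simp add: Cons)
        then show ?thesis
          using Suc.prems(3)[OF _ t, of "True # x'"] Suc.prems(3)[OF _ t, of "False # add2 x' t"] True
          by (auto simp: Cons V'_def)
      qed (simp add: Cons V'_def)
    qed (use that in simp)
    define y' where "y' = (if b then add2 y t else y)"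
    have "y' \<notin> V'" "length y' = n" using shift[of w] Suc.prems(5) w lt by (auto simp: y'_def)
    from IH[OF this(2,1)] obtain c where c: "length c = n" "\<forall>x\<in>V'. \<not> dot2 c x" "dot2 c y'" by blast
    have "\<not> dot2 (dot2 c t # c) x" if "x \<in> V" for x
    proof -
      obtain h x' where x: "x = h # x'" "length x' = n" using Suc.prems(2)[OF \<open>x \<in> V\<close>] by (cases x) auto
      have "\<not> dot2 c (if h then add2 x' t else x')"
        using shift[of x] \<open>x \<in> V\<close> c(2) x unfolding x(1) list.sel by fastforce
      moreover have "dot2 c (add2 x' t) = (dot2 c x' \<noteq> dot2 c t)"
        using c(1) x lt by (intro dot2_add2) auto
      ultimately show ?thesis by (cases h) (auto simp: x(1))
    qed
    moreover have "dot2 (dot2 c t # c) w"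
    proof -
      have "dot2 c (add2 y t) = (dot2 c y \<noteq> dot2 c t)"
        using c(1) w lt by (intro dot2_add2) auto
      then show ?thesis using c(3) by (cases b) (auto simp: w(1) y'_def)
    qed
    ultimately show ?thesis using c(1) by (intro exI[of _ "dot2 c t # c"]) auto
  qed
qed

section \<open>The roots of the octic\<close>

abbreviation sg :: "bool \<Rightarrow> complex" where "sg c \<equiv> (if c then - 1 else 1)"

text \<open>Here \<open>s\<close> is the square root of the constant term. With \<open>r\<^sup>2 = s\<close>, the map \<open>x \<mapsto> r / x\<close> permutes the roots.\<close>

locale biquadratic_octic =
  fixes a s :: rat and f :: "rat poly" and \<alpha> r :: complex
  assumes f: "f = Polynomial.monom 1 8 + Polynomial.monom a 4 + [:s\<^sup>2:]"
    and irr: "Factorial_Ring.irreducible f"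
    and s_nonneg: "s \<ge> 0"
    and \<alpha>_root: "eval_rat f \<alpha> = 0" and r: "r\<^sup>2 = of_rat s"
begin

lemma eval_f: "eval_rat f z = z ^ 8 + of_rat a * z ^ 4 + of_rat s ^ 2"
proof -
  have "map_poly of_rat f = Polynomial.monom 1 8 + Polynomial.monom (of_rat a) 4 + ([:of_rat (s\<^sup>2):] :: complex poly)"
    unfolding f by (simp add: of_rat_poly_hom map_poly_monom map_poly_pCons)
  then show ?thesis by (simp add: poly_monom of_rat_power)
qed

lemma \<alpha>_eq: "\<alpha> ^ 8 = - of_rat a * \<alpha> ^ 4 - of_rat s ^ 2"
proof -
  have "\<alpha> ^ 8 = (\<alpha> ^ 8 + of_rat a * \<alpha> ^ 4 + of_rat s ^ 2) - of_rat a * \<alpha> ^ 4 - of_rat s ^ 2"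
    by simp
  then show ?thesis using \<alpha>_root unfolding eval_f by simp
qed

lemma degree_f: "degree f = 8"
proof (rule antisym)
  show "degree f \<le> 8"
    unfolding f by (intro degree_add_le) (auto intro: order.trans[OF degree_monom_le])
  show "8 \<le> degree f"
    by (rule le_degree) (simp add: f coeff_pCons')
qed

lemma f_dvd: "eval_rat p \<alpha> = 0 \<Longrightarrow> f dvd p"
  using eval_rat_eq_0_iff_dvd[OF irr \<alpha>_root] by simp

text \<open>Otherwise \<open>\<alpha>\<close> would be a root of a polynomial of degree 4.\<close>

lemma \<alpha>4_irrational: "\<alpha> ^ 4 \<noteq> of_rat q"
proof
  assume *: "\<alpha> ^ 4 = of_rat q"
  let ?p = "Polynomial.monom 1 4 - [:q:]"
  have p: "?p = Polynomial.monom 1 4 + [:- q:]" by simp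
  have "eval_rat ?p \<alpha> = 0"
    using * unfolding p by (simp add: of_rat_poly_hom map_poly_monom map_poly_pCons poly_monom of_rat_minus)
  then have "f dvd ?p" by (rule f_dvd)
  moreover have "degree ?p \<le> 4" by (intro degree_diff_le) (auto intro: order.trans[OF degree_monom_le])
  moreover have "coeff ?p 4 = 1" by (simp add: coeff_pCons')
  then have "?p \<noteq> 0" by force
  ultimately show False using dvd_imp_degree_le[of f ?p] degree_f by simp
qed

lemma \<alpha>_nz: "\<alpha> \<noteq> 0"
  using \<alpha>4_irrational[of 0] by auto

lemma s_pos: "s > 0"
proof -
  have "s \<noteq> 0"
  proof
    assume "s = 0"
    then have "\<alpha> ^ 4 * (\<alpha> ^ 4 + of_rat a) = 0" using \<alpha>_eq by (simp add: algebra_simps flip: power_add)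
    then have "\<alpha> ^ 4 = of_rat (- a)" using \<alpha>_nz by (simp add: of_rat_minus eq_neg_iff_add_eq_0)
    then show False using \<alpha>4_irrational by blast
  qed
  then show ?thesis using s_nonneg by simp
qed

lemma r_nz: "r \<noteq> 0"
  using r s_pos by auto

fun root :: "bool \<times> bool \<times> bool \<Rightarrow> complex" where
  "root (z, k, e) = sg z * (if k then \<i> else 1) * (if e then r / \<alpha> else \<alpha>)"

lemma \<alpha>4_sum: "\<alpha> ^ 4 + of_rat s ^ 2 / \<alpha> ^ 4 = - of_rat a"
proof -
  have "\<alpha> ^ 4 * (\<alpha> ^ 4 + of_rat s ^ 2 / \<alpha> ^ 4) = \<alpha> ^ 8 + of_rat s ^ 2"
    using \<alpha>_nz by (simp add: distrib_left flip: power_add)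
  also have "\<dots> = \<alpha> ^ 4 * (- of_rat a)" using \<alpha>_eq by simp
  finally show ?thesis using \<alpha>_nz by (subst (asm) mult_left_cancel) simp_all
qed

lemma r4: "r ^ 4 = of_rat s ^ 2"
  using r by (metis mult_2 numeral_Bit0 power_mult power2_eq_square power_add)

lemma fourth_power_eq: "(x::complex) ^ 4 = y ^ 4 \<longleftrightarrow> x = y \<or> x = - y \<or> x = \<i> * y \<or> x = - (\<i> * y)"
proof -
  have "x ^ 4 - y ^ 4 = (x - y) * (x + y) * (x - \<i> * y) * (x + \<i> * y)"
    by (simp add: algebra_simps power2_eq_square numeral_eq_Suc)
  then have "x ^ 4 - y ^ 4 = 0 \<longleftrightarrow> x - y = 0 \<or> x + y = 0 \<or> x - \<i> * y = 0 \<or> x + \<i> * y = 0"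
    by simp
  then show ?thesis by (simp add: eq_neg_iff_add_eq_0)
qed

text \<open>As a polynomial in \<open>x\<^sup>4\<close>, \<open>f\<close> has the two roots \<open>\<alpha>\<^sup>4\<close> and \<open>s\<^sup>2 / \<alpha>\<^sup>4 = (r / \<alpha>)\<^sup>4\<close>.\<close>

lemma root_range: "eval_rat f z = 0 \<longleftrightarrow> z \<in> range root"
proof -
  have "(Z - A) * (Z - W) = Z * Z - (A + W) * Z + A * W" for Z A W :: complex
    by (simp add: algebra_simps)
  from this[of "z ^ 4" "\<alpha> ^ 4" "of_rat s ^ 2 / \<alpha> ^ 4"]
  have "eval_rat f z = (z ^ 4 - \<alpha> ^ 4) * (z ^ 4 - (r / \<alpha>) ^ 4)"
    unfolding \<alpha>4_sum power_divide r4 eval_f using \<alpha>_nz by (simp flip: power_add)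
  then have "eval_rat f z = 0 \<longleftrightarrow> z ^ 4 = \<alpha> ^ 4 \<or> z ^ 4 = (r / \<alpha>) ^ 4" by simp
  also have "\<dots> \<longleftrightarrow> (\<exists>z' k e. z = root (z', k, e))"
    unfolding fourth_power_eq by (simp add: ex_bool_eq) blast
  finally show ?thesis by (auto simp: image_iff)
qed

lemma complex_roots_eq: "complex_roots f = range root"
  using root_range by (auto simp: complex_roots_def)

text \<open>A coincidence between the two kinds of roots would make \<open>\<alpha>\<^sup>4\<close> the rational number \<open>- a / 2\<close>.\<close>

lemma inj_root: "inj root"
proof (rule injI)
  fix x y assume eq: "root x = root y"
  obtain z k e z' k' e' where xy: "x = (z, k, e)" "y = (z', k', e')" by (metis surj_pair)
  have r4': "(r / \<alpha>) ^ 4 \<noteq> \<alpha> ^ 4"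
  proof
    assume "(r / \<alpha>) ^ 4 = \<alpha> ^ 4"
    then have "\<alpha> ^ 4 + \<alpha> ^ 4 = - of_rat a"
      using \<alpha>4_sum unfolding power_divide r4 by simp
    moreover have "\<alpha> ^ 4 = (\<alpha> ^ 4 + \<alpha> ^ 4) / 2" by simp
    ultimately have "\<alpha> ^ 4 = of_rat (- a / 2)" by (simp only: of_rat_divide of_rat_minus) simp
    then show False using \<alpha>4_irrational by blast
  qed
  have "root (z, k, e) ^ 4 = (if e then r / \<alpha> else \<alpha>) ^ 4" for z k e
    by (simp add: power_mult_distrib)
  then have "e = e'" using arg_cong[OF eq, of "\<lambda>x. x ^ 4"] r4' unfolding xy by (auto split: if_splits)
  moreover have "z = z' \<and> k = k'"
  proof -
    have nz: "(if e' then r / \<alpha> else \<alpha>) \<noteq> 0" using \<alpha>_nz r_nz by simp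
    have "sg z * (if k then \<i> else 1) = sg z' * (if k' then \<i> else 1)"
      using eq unfolding xy \<open>e = e'\<close> root.simps mult_right_cancel[OF nz] .
    then show ?thesis
      by (cases z; cases k; cases z'; cases k') (auto simp: complex_eq_iff)
  qed
  ultimately show "x = y" by (simp add: xy)
qed

end

section \<open>Embeddings of the splitting field\<close>

lemma complex_field: "field (ring_of_type_algebra :: complex ring)"
  by (rule field_from_type_algebra)

lemma complex_ring_simps [simp]:
  "carrier (ring_of_type_algebra :: complex ring) = UNIV"
  "\<zero>\<^bsub>ring_of_type_algebra\<^esub> = (0::complex)" "\<one>\<^bsub>ring_of_type_algebra\<^esub> = (1::complex)"
  "x \<oplus>\<^bsub>ring_of_type_algebra\<^esub> y = (x + y :: complex)" "x \<otimes>\<^bsub>ring_of_type_algebra\<^esub> y = (x * y :: complex)"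
  by (simp_all add: ring_of_type_algebra_def)

lemma complex_ring_inverses:
  "\<ominus>\<^bsub>ring_of_type_algebra\<^esub> x = (- x :: complex)"
  "x \<noteq> 0 \<Longrightarrow> inv\<^bsub>ring_of_type_algebra\<^esub> x = (inverse x :: complex)"
proof -
  interpret R: field "ring_of_type_algebra :: complex ring" by (rule complex_field)
  show "\<ominus>\<^bsub>ring_of_type_algebra\<^esub> x = - x" by (rule R.minus_equality) simp_all
  show "inv\<^bsub>ring_of_type_algebra\<^esub> x = inverse x" if "x \<noteq> 0" using that by (intro R.comm_inv_char) simp_all
qed

lemma subfield_generate_field: "subfield_of_complex (generate_field ring_of_type_algebra H)"
proof -
  let ?K = "generate_field ring_of_type_algebra H"
  have 1: "1 \<in> ?K" using generate_field.one[of "ring_of_type_algebra :: complex ring" H] by simp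
  have m: "- x \<in> ?K" if "x \<in> ?K" for x
    using generate_field.a_inv[OF that] by (simp add: complex_ring_inverses)
  have a: "x + y \<in> ?K" if "x \<in> ?K" "y \<in> ?K" for x y
    using generate_field.eng_add[OF that] by simp
  have t: "x * y \<in> ?K" if "x \<in> ?K" "y \<in> ?K" for x y
    using generate_field.eng_mult[OF that] by simp
  have i: "inverse x \<in> ?K" if "x \<in> ?K" for x
  proof (cases "x = 0")
    case False
    then show ?thesis using generate_field.m_inv[OF that] by (simp add: complex_ring_inverses)
  next
    case True
    then show ?thesis using a[OF 1 m[OF 1]] by simp
  qed
  show ?thesis using 1 m a t i by (simp add: subfield_of_complex_def)
qed

lemma generate_field_subset:
  assumes K: "subfield_of_complex K" and "H \<subseteq> K"
  shows "generate_field ring_of_type_algebra H \<subseteq> K"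
proof
  fix x assume "x \<in> generate_field ring_of_type_algebra H"
  then show "x \<in> K"
    using assms subfield_closed(1-5)[OF K]
    by induction (auto simp: complex_ring_inverses)
qed

lemma embedding_mono: "embedding K \<phi> \<Longrightarrow> L \<subseteq> K \<Longrightarrow> embedding L \<phi>"
  unfolding embedding_def by (meson subsetD)

context biquadratic_octic
begin

abbreviation "L \<equiv> splitting_field f"

lemma L: "subfield_of_complex L"
  unfolding splitting_field_def by (rule subfield_generate_field)

lemmas L_closed = subfield_closed[OF L]

lemma root_in_L: "root x \<in> L"
  unfolding splitting_field_def by (rule generate_field.incl) (simp add: complex_roots_eq)

lemma \<alpha>_in_L: "\<alpha> \<in> L"
  using root_in_L[of "(False, False, False)"] by simp

lemma \<i>_in_L: "\<i> \<in> L"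
  using L_closed(7)[OF root_in_L[of "(False, True, False)"] \<alpha>_in_L] \<alpha>_nz by simp

lemma r_in_L: "r \<in> L"
  using L_closed(5)[OF root_in_L[of "(False, False, True)"] \<alpha>_in_L] \<alpha>_nz by simp

text \<open>The splitting field is generated by \<open>\<alpha>\<close>, \<open>\<i>\<close> and \<open>r\<close>, so embeddings are determined by three values.\<close>

lemma L_subset:
  assumes K: "subfield_of_complex K" and "\<alpha> \<in> K" "\<i> \<in> K" "r \<in> K"
  shows "L \<subseteq> K"
proof -
  note closed = subfield_closed[OF K]
  have "root x \<in> K" for x
  proof (cases x)
    case (fields z k e)
    have "sg z \<in> K" "(if k then \<i> else 1) \<in> K" "(if e then r / \<alpha> else \<alpha>) \<in> K"
      using closed(1) closed(2)[OF closed(1)] closed(7)[OF assms(4,2)] assms by simp_all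
    then show ?thesis unfolding fields root.simps by (intro closed(5))
  qed
  moreover have "range of_rat \<subseteq> K" using of_rat_in_subfield[OF K] by blast
  ultimately show ?thesis
    unfolding splitting_field_def complex_roots_eq by (intro generate_field_subset K) auto
qed

definition realises :: "(complex \<Rightarrow> complex) \<Rightarrow> symmetry \<Rightarrow> bool" where
  "realises \<phi> = (\<lambda>(z, k, e, u, v). embedding L \<phi> \<and>
     \<phi> \<alpha> = root (z, k, e) \<and> \<phi> \<i> = sg u * \<i> \<and> \<phi> r = sg v * r)"

lemma realises_embedding: "realises \<phi> t \<Longrightarrow> field_embedding L \<phi>"
  by (cases t) (simp add: realises_def field_embedding_def L)

lemma embedding_root:
  assumes "embedding L \<phi>" "eval_rat f x = 0" "x \<in> L"
  shows "\<phi> x \<in> range root"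
proof -
  interpret field_embedding L \<phi> using L assms(1) by unfold_locales
  have in_L: "x ^ n \<in> L" "of_rat q * x ^ n \<in> L" "of_rat q \<in> L" "of_rat q ^ n \<in> L" for n q
    using closed(9)[OF assms(3)] closed(5) of_rat_in_subfield[OF L] closed(9) by blast+
  have "\<phi> (eval_rat f x) = eval_rat f (\<phi> x)"
    unfolding eval_f by (simp add: add mult power in_L closed(4) assms(3))
  then have "eval_rat f (\<phi> x) = 0" using assms(2) by simp
  then show ?thesis by (simp add: root_range)
qed

lemma embedding_realises:
  assumes "embedding L \<phi>"
  obtains z k e u v where "realises \<phi> (z, k, e, u, v)" "\<phi> \<alpha> = root (z, k, e)"
proof -
  interpret field_embedding L \<phi> using L assms by unfold_locales
  obtain z k e where \<alpha>: "\<phi> \<alpha> = root (z, k, e)"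
    using embedding_root[OF assms \<alpha>_root \<alpha>_in_L] by (metis imageE surj_pair)
  have "\<phi> \<i> ^ 2 = \<phi> (of_rat (- 1))" using power[OF \<i>_in_L, of 2] by (simp add: of_rat_minus power2_eq_square)
  then have "\<phi> \<i> ^ 2 = \<i> ^ 2" by (simp only: of_rat) (simp add: of_rat_minus)
  then have "\<phi> \<i> = \<i> \<or> \<phi> \<i> = - \<i>" by (simp only: power2_eq_iff)
  then have \<i>: "\<exists>u. \<phi> \<i> = sg u * \<i>" by (metis mult_1 mult_minus1)
  have "\<phi> r ^ 2 = r ^ 2" using power[OF r_in_L, of 2] by (simp add: r)
  then have "\<phi> r = r \<or> \<phi> r = - r" by (simp only: power2_eq_iff)
  then have "\<exists>v. \<phi> r = sg v * r" by (metis mult_1 mult_minus1)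
  with \<alpha> \<i> that assms show ?thesis unfolding realises_def by blast
qed

text \<open>The action of a quintuple on root labels. Padding the label with \<open>False\<close> is harmless: the last two
  bits of the second factor do not enter the first three bits of a product.\<close>

fun act :: "symmetry \<Rightarrow> bool \<times> bool \<times> bool \<Rightarrow> bool \<times> bool \<times> bool" where
  "act t (z, k, e) = (case gamma_mult t (z, k, e, False, False) of (z, k, e, u, v) \<Rightarrow> (z, k, e))"

lemma realises_root:
  assumes "realises \<phi> t"
  shows "\<phi> (root x) = root (act t x)"
proof -
  interpret field_embedding L \<phi> by (rule realises_embedding[OF assms])
  obtain z k e u v z' k' e' where tx: "t = (z, k, e, u, v)" "x = (z', k', e')" by (metis surj_pair)
  have \<phi>: "\<phi> \<alpha> = root (z, k, e)" "\<phi> \<i> = sg u * \<i>" "\<phi> r = sg v * r"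
    using assms by (simp_all add: realises_def tx)
  have in_L: "sg z' \<in> L" "(if k' then \<i> else 1) \<in> L" "(if e' then r / \<alpha> else \<alpha>) \<in> L"
    using closed(1) closed(2)[OF closed(1)] closed(7)[OF r_in_L \<alpha>_in_L] \<alpha>_in_L \<i>_in_L by simp_all
  have "\<phi> (root x) = \<phi> (sg z') * \<phi> (if k' then \<i> else 1) * \<phi> (if e' then r / \<alpha> else \<alpha>)"
    unfolding tx root.simps using in_L closed(5) by (simp only: mult)
  also have "\<phi> (sg z') = sg z'" using minus[OF closed(1)] by simp
  also have "\<phi> (if k' then \<i> else 1) = (if k' then sg u * \<i> else 1)" by (simp add: \<phi>)
  also have "\<phi> (if e' then r / \<alpha> else \<alpha>) = (if e' then sg v * r / root (z, k, e) else root (z, k, e))"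
    by (simp add: divide r_in_L \<alpha>_in_L \<phi>(1,3))
  also have "sg z' * (if k' then sg u * \<i> else 1) * (if e' then sg v * r / root (z, k, e) else root (z, k, e)) = root (act t x)"
    unfolding tx using \<alpha>_nz r_nz
    by (cases z; cases k; cases e; cases u; cases v; cases k'; cases e') (simp_all add: divide_simps)
  finally show ?thesis .
qed

end

section \<open>The formal symmetries that are realised\<close>

context biquadratic_octic
begin

text \<open>The square of the companion root \<open>r / \<alpha>\<close>. The numbers \<open>\<alpha>\<^sup>2 + \<beta>\<close> and \<open>\<alpha>\<^sup>2 - \<beta>\<close> are
  square roots of rational numbers, which makes the fixed field of \<open>\<alpha> \<mapsto> -\<alpha>\<close> multiquadratic.\<close>

definition \<beta> :: complex where "\<beta> = of_rat s / \<alpha>\<^sup>2"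

text \<open>The character of \<open>Gamma\<close> with exponent vector \<open>c\<close>, written additively: it is the sign by which a symmetry
  multiplies \<open>radical c\<close>.\<close>

definition sign_char :: "bool \<times> bool \<times> bool \<times> bool \<Rightarrow> symmetry \<Rightarrow> bool" where
  "sign_char = (\<lambda>(c1, c2, c3, c4) (z, k, e, u, v). ((c1 \<and> u) \<noteq> (c2 \<and> v)) \<noteq> ((c3 \<and> k) \<noteq> (c4 \<and> (k \<noteq> e))))"

definition radical :: "bool \<times> bool \<times> bool \<times> bool \<Rightarrow> complex" where
  "radical = (\<lambda>(c1, c2, c3, c4). (if c1 then \<i> else 1) * (if c2 then r else 1) *
     (if c3 then \<alpha>\<^sup>2 + \<beta> else 1) * (if c4 then \<alpha>\<^sup>2 - \<beta> else 1))"

definition radicand :: "bool \<times> bool \<times> bool \<times> bool \<Rightarrow> rat" where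
  "radicand = (\<lambda>(c1, c2, c3, c4). (if c1 then - 1 else 1) * (if c2 then s else 1) *
     (if c3 then 2 * s - a else 1) * (if c4 then - (a + 2 * s) else 1))"

lemma \<beta>_in_L: "\<beta> \<in> L"
  unfolding \<beta>_def by (intro L_closed of_rat_in_subfield[OF L] \<alpha>_in_L)

lemma \<alpha>\<beta>: "\<alpha>\<^sup>2 * \<beta> = of_rat s"
  using \<alpha>_nz by (simp add: \<beta>_def)

lemma \<alpha>\<beta>_squares: "(\<alpha>\<^sup>2 + \<beta>)\<^sup>2 = of_rat (2 * s - a)" "(\<alpha>\<^sup>2 - \<beta>)\<^sup>2 = of_rat (- (a + 2 * s))"
proof -
  have "\<alpha> ^ 4 + \<beta>\<^sup>2 = - of_rat a"
    using \<alpha>4_sum by (simp add: \<beta>_def power_divide flip: power_mult)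
  then have *: "(\<alpha>\<^sup>2)\<^sup>2 + \<beta>\<^sup>2 = - of_rat a" by (simp flip: power_mult)
  have "(\<alpha>\<^sup>2 + \<beta>)\<^sup>2 = ((\<alpha>\<^sup>2)\<^sup>2 + \<beta>\<^sup>2) + 2 * (\<alpha>\<^sup>2 * \<beta>)"
    by (simp add: power2_eq_square algebra_simps)
  also have "\<dots> = of_rat (2 * s - a)" unfolding * \<alpha>\<beta> by (simp add: of_rat_diff of_rat_mult)
  finally show "(\<alpha>\<^sup>2 + \<beta>)\<^sup>2 = of_rat (2 * s - a)" .
  have "(\<alpha>\<^sup>2 - \<beta>)\<^sup>2 = ((\<alpha>\<^sup>2)\<^sup>2 + \<beta>\<^sup>2) - 2 * (\<alpha>\<^sup>2 * \<beta>)"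
    by (simp add: power2_eq_square algebra_simps)
  also have "\<dots> = of_rat (- (a + 2 * s))" unfolding * \<alpha>\<beta> by (simp add: of_rat_diff of_rat_mult of_rat_minus of_rat_add)
  finally show "(\<alpha>\<^sup>2 - \<beta>)\<^sup>2 = of_rat (- (a + 2 * s))" .
qed

lemma radical_square: "(radical c)\<^sup>2 = of_rat (radicand c)"
  by (cases c) (simp add: radical_def radicand_def power_mult_distrib r \<alpha>\<beta>_squares of_rat_mult of_rat_minus)

lemma \<alpha>\<beta>_nz: "\<alpha>\<^sup>2 + \<beta> \<noteq> 0" "\<alpha>\<^sup>2 - \<beta> \<noteq> 0"
proof -
  have "(\<alpha>\<^sup>2 + \<beta>) * \<alpha>\<^sup>2 = \<alpha> ^ 4 + of_rat s" "(\<alpha>\<^sup>2 - \<beta>) * \<alpha>\<^sup>2 = \<alpha> ^ 4 - of_rat s"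
    unfolding ring_distribs left_diff_distrib using \<alpha>\<beta> by (simp_all add: mult.commute flip: power_add)
  moreover have "\<alpha> ^ 4 + of_rat s \<noteq> 0" "\<alpha> ^ 4 - of_rat s \<noteq> 0"
    using \<alpha>4_irrational[of s] \<alpha>4_irrational[of "- s"] by (simp_all add: of_rat_minus eq_neg_iff_add_eq_0)
  ultimately show "\<alpha>\<^sup>2 + \<beta> \<noteq> 0" "\<alpha>\<^sup>2 - \<beta> \<noteq> 0" by force+
qed

lemma radical_nz: "radical c \<noteq> 0"
  using \<alpha>\<beta>_nz by (cases c) (simp add: radical_def r_nz)

lemma realises_radical:
  assumes "realises \<phi> t"
  shows "\<phi> (radical c) = sg (sign_char c t) * radical c"
proof -
  interpret field_embedding L \<phi> by (rule realises_embedding[OF assms])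
  obtain z k e u v where t: "t = (z, k, e, u, v)" by (metis surj_pair)
  have \<phi>: "\<phi> \<alpha> = root (z, k, e)" "\<phi> \<i> = sg u * \<i>" "\<phi> r = sg v * r"
    using assms by (simp_all add: realises_def t)
  have \<beta>': "of_rat s / \<beta> = \<alpha>\<^sup>2" using s_pos \<alpha>_nz by (simp add: \<beta>_def)
  have \<alpha>2: "\<phi> (\<alpha>\<^sup>2) = sg k * (if e then \<beta> else \<alpha>\<^sup>2)"
    by (simp add: power \<alpha>_in_L \<phi>(1) power_mult_distrib power_divide r \<beta>_def)
  have "\<phi> \<beta> = of_rat s / \<phi> (\<alpha>\<^sup>2)"
    unfolding \<beta>_def using of_rat_in_subfield[OF L] closed(9)[OF \<alpha>_in_L] by (simp add: divide)
  also have "\<dots> = sg k * (if e then \<alpha>\<^sup>2 else \<beta>)"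
    unfolding \<alpha>2 using \<beta>' by (cases e; cases k) (simp_all add: \<beta>_def)
  finally have \<phi>\<beta>: "\<phi> \<beta> = sg k * (if e then \<alpha>\<^sup>2 else \<beta>)" .
  have P: "\<phi> (\<alpha>\<^sup>2 + \<beta>) = sg k * (\<alpha>\<^sup>2 + \<beta>)" and N: "\<phi> (\<alpha>\<^sup>2 - \<beta>) = sg (k \<noteq> e) * (\<alpha>\<^sup>2 - \<beta>)"
    using closed(9)[OF \<alpha>_in_L] \<beta>_in_L by (simp_all add: add diff \<alpha>2 \<phi>\<beta>)
  have PN: "\<alpha>\<^sup>2 + \<beta> \<in> L" "\<alpha>\<^sup>2 - \<beta> \<in> L"
    by (intro L_closed \<alpha>_in_L \<beta>_in_L)+
  obtain c1 c2 c3 c4 where c: "c = (c1, c2, c3, c4)" by (metis surj_pair)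
  have "\<phi> (radical c) = \<phi> (if c1 then \<i> else 1) * \<phi> (if c2 then r else 1) *
     \<phi> (if c3 then \<alpha>\<^sup>2 + \<beta> else 1) * \<phi> (if c4 then \<alpha>\<^sup>2 - \<beta> else 1)"
    unfolding c radical_def prod.case using PN \<i>_in_L r_in_L closed(1)
    by (cases c1; cases c2; cases c3; cases c4; simp only: if_True if_False mult closed(5))
  also have "\<dots> = (if c1 then sg u * \<i> else 1) * (if c2 then sg v * r else 1) *
     (if c3 then sg k * (\<alpha>\<^sup>2 + \<beta>) else 1) * (if c4 then sg (k \<noteq> e) * (\<alpha>\<^sup>2 - \<beta>) else 1)"
    by (simp only: if_distrib[of \<phi>] P N \<phi> one)
  also have "\<dots> = sg (sign_char c t) * radical c"
    unfolding c t radical_def sign_char_def prod.case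
    by (cases c1; cases c2; cases c3; cases c4) simp_all
  finally show ?thesis .
qed

definition realised :: "symmetry set" where "realised = {t. \<exists>\<phi>. realises \<phi> t}"

text \<open>Irreducibility gives an embedding of \<open>\<rat>(\<alpha>)\<close> with any prescribed root as image of \<open>\<alpha>\<close>; it extends
  to \<open>\<i>\<close> and \<open>r\<close>.\<close>

lemma realised_transitive: "\<exists>u v. (z, k, e, u, v) \<in> realised"
proof -
  have "eval_rat f (root (z, k, e)) = 0" using root_range by blast
  from adjoin_root[OF irr \<alpha>_root this] obtain K0 \<phi>0
    where 0: "subfield_of_complex K0" "embedding K0 \<phi>0" "\<alpha> \<in> K0" "\<phi>0 \<alpha> = root (z, k, e)" by blast
  have "list_all (\<lambda>\<delta>. \<delta> ^ 2 \<in> K0) [\<i>, r]"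
    using subfield_closed(1,2)[OF 0(1)] of_rat_in_subfield[OF 0(1)] by (simp add: r)
  then obtain K \<phi> where 1: "subfield_of_complex K" "embedding K \<phi>" "K0 \<subseteq> K" "set [\<i>, r] \<subseteq> K"
    "\<And>x. x \<in> K0 \<Longrightarrow> \<phi> x = \<phi>0 x" by (rule extend_to_square_roots[OF 0(1,2)]) (rule that)
  have "embedding L \<phi>"
    by (rule embedding_mono[OF 1(2) L_subset[OF 1(1)]]) (use 0(3) 1(3,4) in auto)
  then obtain z' k' e' u v where "realises \<phi> (z', k', e', u, v)" "\<phi> \<alpha> = root (z', k', e')"
    by (rule embedding_realises)
  moreover from this have "root (z', k', e') = root (z, k, e)" using 1(5)[OF 0(3)] 0(4) by simp
  then have "(z', k', e') = (z, k, e)" by (rule injD[OF inj_root])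
  ultimately show ?thesis unfolding realised_def by blast
qed

text \<open>Start with the nontrivial automorphism of \<open>\<rat>(\<surd>d)\<close> and extend it, one square root at a
  time, until the field contains the whole splitting field.\<close>

lemma realised_moves_nonsquare:
  assumes "\<not> is_square (radicand c)"
  shows "\<exists>t\<in>realised. sign_char c t"
proof -
  define D where "D = radical c"
  have Q: "subfield_of_complex \<rat>" by (simp add: subfield_of_complex_def)
  have id: "embedding \<rat> id" by (simp add: embedding_def)
  have "D ^ 2 \<in> \<rat>" by (simp add: D_def radical_square)
  moreover have "D \<notin> \<rat>"
  proof
    assume "D \<in> \<rat>"
    then obtain q where "D = of_rat q" by (rule Rats_cases)
    then have "of_rat (q ^ 2) = (of_rat (radicand c) :: complex)"
      using radical_square[of c] by (simp add: D_def of_rat_power)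
    then have "radicand c = q ^ 2" by (simp only: of_rat_eq_iff)
    then show False using assms by (auto intro: is_nth_powerI)
  qed
  moreover have "(- D) ^ 2 = id (D ^ 2)" by simp
  ultimately obtain K0 \<phi>0 where 0: "subfield_of_complex K0" "embedding K0 \<phi>0" "\<rat> \<subseteq> K0" "D \<in> K0"
    "\<And>x. x \<in> \<rat> \<Longrightarrow> \<phi>0 x = id x" "\<phi>0 D = - D"
    by (rule adjoin_square_root[OF Q id]) (rule that)
  have "list_all (\<lambda>\<delta>. \<delta> ^ 2 \<in> K0) [\<i>, r, \<alpha>\<^sup>2 + \<beta>, \<alpha>\<^sup>2 - \<beta>]"
    using subfield_closed(1,2)[OF 0(1)] of_rat_in_subfield[OF 0(1)] by (simp add: r \<alpha>\<beta>_squares)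
  then obtain K1 \<phi>1 where 1: "subfield_of_complex K1" "embedding K1 \<phi>1" "K0 \<subseteq> K1" 
      "set [\<i>, r, \<alpha>\<^sup>2 + \<beta>, \<alpha>\<^sup>2 - \<beta>] \<subseteq> K1"
    "\<And>x. x \<in> K0 \<Longrightarrow> \<phi>1 x = \<phi>0 x" by (rule extend_to_square_roots[OF 0(1,2)]) (rule that)
  \<comment> \<open>Only \<open>\<alpha>\<close> itself is still missing, and its square is now available.\<close>
  have "\<alpha>\<^sup>2 = ((\<alpha>\<^sup>2 + \<beta>) + (\<alpha>\<^sup>2 - \<beta>)) / of_rat 2" by simp
  also have "\<dots> \<in> K1"
    by (rule subfield_closed(7)[OF 1(1) subfield_closed(4)[OF 1(1)] of_rat_in_subfield[OF 1(1)]]) (use 1(4) in auto)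
  finally have "\<alpha>\<^sup>2 \<in> K1" .
  then obtain K \<phi> where 2: "subfield_of_complex K" "embedding K \<phi>" "K1 \<subseteq> K" "\<alpha> \<in> K"
    "\<And>x. x \<in> K1 \<Longrightarrow> \<phi> x = \<phi>1 x" by (rule extend_to_square_root[OF 1(1,2)]) (rule that)
  have "embedding L \<phi>"
    by (rule embedding_mono[OF 2(2) L_subset[OF 2(1)]]) (use 1(4) 2(3,4) in auto)
  then obtain z k e u v where t: "realises \<phi> (z, k, e, u, v)" by (rule embedding_realises)
  have "\<phi> D = - D" using 2(5)[of D] 1(5)[OF 0(4)] 0(6) subsetD[OF 1(3) 0(4)] by simp
  then have "sign_char c (z, k, e, u, v)"
    using realises_radical[OF t, of c] radical_nz[of c] by (auto simp: D_def split: if_splits)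
  with t show ?thesis unfolding realised_def by blast
qed

lemma realised_fixes_square:
  assumes "is_square (radicand c)" "t \<in> realised"
  shows "\<not> sign_char c t"
proof -
  obtain \<phi> where t: "realises \<phi> t" using assms(2) by (auto simp: realised_def)
  interpret field_embedding L \<phi> by (rule realises_embedding[OF t])
  obtain q where "radicand c = q ^ 2" using assms(1) by (auto elim: is_nth_powerE)
  then have "radical c ^ 2 = of_rat q ^ 2" by (simp add: radical_square of_rat_power)
  then have "radical c = of_rat q \<or> radical c = of_rat (- q)" by (simp add: power2_eq_iff of_rat_minus)
  then have "\<phi> (radical c) = radical c" using of_rat by metis
  then show ?thesis using realises_radical[OF t, of c] radical_nz[of c] by (auto split: if_splits)
qed

lemma realises_in_L:
  assumes t: "realises \<phi> t" and x: "x \<in> L"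
  shows "\<phi> x \<in> L"
proof -
  interpret field_embedding L \<phi> by (rule realises_embedding[OF t])
  have sub: "subfield_of_complex {x \<in> L. \<phi> x \<in> L}"
    unfolding subfield_of_complex_def by (simp add: add mult minus inverse L_closed(1-5))
  obtain z k e u v where "t = (z, k, e, u, v)" by (metis surj_pair)
  then have vals: "\<phi> \<alpha> = root (z, k, e)" "\<phi> \<i> = sg u * \<i>" "\<phi> r = sg v * r"
    using t by (simp_all add: realises_def)
  have sg: "sg b * y \<in> L" if "y \<in> L" for b y
    using L_closed(2)[OF that] that by (cases b) simp_all
  have "\<phi> \<alpha> \<in> L" "\<phi> \<i> \<in> L" "\<phi> r \<in> L"
    unfolding vals by (rule root_in_L, rule sg[OF \<i>_in_L], rule sg[OF r_in_L])
  then have "L \<subseteq> {x \<in> L. \<phi> x \<in> L}"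
    by (intro L_subset[OF sub]) (simp_all only: mem_Collect_eq \<alpha>_in_L \<i>_in_L r_in_L simp_thms)
  then show ?thesis using x by blast
qed

lemma realised_subgroup: "subgroup realised Gamma"
proof -
  interpret group Gamma by (rule group_Gamma)
  have mult: "gamma_mult t t' \<in> realised" if ts: "t \<in> realised" "t' \<in> realised" for t t'
  proof -
    obtain \<phi> \<psi> where r: "realises \<phi> t" "realises \<psi> t'" using ts by (auto simp: realised_def)
    obtain z k e u v z' k' e' u' v' where t: "t = (z, k, e, u, v)" "t' = (z', k', e', u', v')" by (metis surj_pair)
    interpret \<phi>: field_embedding L \<phi> by (rule realises_embedding[OF r(1)])
    interpret \<psi>: field_embedding L \<psi> by (rule realises_embedding[OF r(2)])
    have t'_vals: "\<psi> \<alpha> = root (z', k', e')" "\<psi> \<i> = sg u' * \<i>" "\<psi> r = sg v' * r"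
      and t_vals: "\<phi> \<i> = sg u * \<i>" "\<phi> r = sg v * r"
      using r by (simp_all add: realises_def t)
    have sg: "\<phi> (sg b * x) = sg b * \<phi> x" "sg b * x \<in> L" if "x \<in> L" for b x
      using that L_closed(2) \<phi>.minus by simp_all
    note \<psi>_L = realises_in_L[OF r(2)]
    have "embedding L (\<phi> \<circ> \<psi>)"
      unfolding embedding_def comp_def
    proof (intro conjI ballI)
      fix x y assume xy: "x \<in> L" "y \<in> L"
      show "\<phi> (\<psi> (x + y)) = \<phi> (\<psi> x) + \<phi> (\<psi> y)" "\<phi> (\<psi> (x * y)) = \<phi> (\<psi> x) * \<phi> (\<psi> y)"
        by (simp_all only: \<psi>.add[OF xy] \<psi>.mult[OF xy] \<phi>.add[OF \<psi>_L[OF xy(1)] \<psi>_L[OF xy(2)]] \<phi>.mult[OF \<psi>_L[OF xy(1)] \<psi>_L[OF xy(2)]])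
    qed simp
    moreover have "\<phi> (\<psi> \<alpha>) = root (act t (z', k', e'))"
      unfolding t'_vals by (rule realises_root[OF r(1)])
    moreover have "\<phi> (\<psi> \<i>) = sg (u \<noteq> u') * \<i>" "\<phi> (\<psi> r) = sg (v \<noteq> v') * r"
      unfolding t'_vals using \<i>_in_L r_in_L by (simp_all only: sg t_vals) simp_all
    ultimately have "realises (\<phi> \<circ> \<psi>) (gamma_mult t t')"
      unfolding realises_def t by simp
    then show ?thesis unfolding realised_def by blast
  qed
  show ?thesis
  proof (rule subgroupI)
    show "realised \<noteq> {}" using realised_transitive by blast
    show "inv\<^bsub>Gamma\<^esub> t \<in> realised" if "t \<in> realised" for t
    proof -
      have "gamma_mult (gamma_mult t t) (gamma_mult t t) = (False, False, False, False, False)" by (cases t) simp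
      then have "inv\<^bsub>Gamma\<^esub> t = gamma_mult t (gamma_mult t t)"
        using m_assoc[of t "gamma_mult t t" t] m_assoc[of t t "gamma_mult t t"] m_assoc[of t t t] by (intro inv_equality) simp_all
      then show ?thesis using mult that by simp
    qed
  qed (use mult in simp_all)
qed

text \<open>By transitivity some realised symmetry sends \<open>\<alpha>\<close> to \<open>-\<alpha>\<close>. If it moves \<open>\<i>\<close> or \<open>r\<close>, it fails to
  commute with a realised symmetry that multiplies \<open>\<alpha>\<close> by \<open>\<i>\<close> or sends it to \<open>r / \<alpha>\<close>, and the only
  nontrivial commutator is \<open>\<alpha> \<mapsto> -\<alpha>\<close>.\<close>

lemma minus_in_realised: "(True, False, False, False, False) \<in> realised"
proof -
  interpret subgroup realised Gamma by (rule realised_subgroup)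
  obtain u v where g: "(True, False, False, u, v) \<in> realised" using realised_transitive by blast
  have comm: "gamma_mult (gamma_mult g h) (gamma_mult g h) \<in> realised \<and> gamma_mult (gamma_mult g g) (gamma_mult h h) \<in> realised" if "g \<in> realised" "h \<in> realised" for g h
    using that m_closed by simp
  obtain u1 v1 where g1: "(False, True, False, u1, v1) \<in> realised" using realised_transitive by blast
  obtain u2 v2 where g2: "(False, False, True, u2, v2) \<in> realised" using realised_transitive by blast
  \<comment> \<open>The quotient of \<open>(g h)\<^sup>2\<close> by \<open>g\<^sup>2 h\<^sup>2\<close> is the commutator of \<open>g\<close> and \<open>h\<close>.\<close>
  note c1 = comm[OF g g1] and c2 = comm[OF g g2]
  show ?thesis
  proof (cases "u \<or> v")
    case True
    then show ?thesis using c1 c2 by (cases u; cases v; cases u1; cases v2; cases u2; cases v1) simp_all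
  qed (use g in simp)
qed

text \<open>Duality in the elementary abelian quotient of \<open>Gamma\<close> by its centre. A quintuple outside the
  realised ones would be separated from them by a character that is trivial on them; its radicand is then a square, so
  the character is among those required to vanish.\<close>

lemma realised_eq: "realised = {t. \<forall>c. is_square (radicand c) \<longrightarrow> \<not> sign_char c t}"
proof (intro equalityI subsetI CollectI allI impI)
  fix t assume t: "t \<in> {t. \<forall>c. is_square (radicand c) \<longrightarrow> \<not> sign_char c t}"
  interpret subgroup realised Gamma by (rule realised_subgroup)
  \<comment> \<open>In these coordinates \<open>sign_char\<close> becomes the dot product with its exponent vector.\<close>
  define vec where "vec = (\<lambda>(z::bool, k, e, u, v). [u, v, k, k \<noteq> (e::bool)])"
  have vec: "vec (gamma_mult x y) = add2 (vec x) (vec y)" for x y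
    by (cases x; cases y) (auto simp: vec_def)
  have sign_char: "sign_char (c1, c2, c3, c4) x = dot2 [c1, c2, c3, c4] (vec x)" for c1 c2 c3 c4 x
    by (cases x) (auto simp: vec_def sign_char_def)
  have "vec t \<in> vec ` realised"
  proof (rule ccontr)
    assume "vec t \<notin> vec ` realised"
    have "\<exists>c. length c = 4 \<and> (\<forall>x\<in>vec ` realised. \<not> dot2 c x) \<and> dot2 c (vec t)"
    proof (rule separating_functional)
      show "add2 x y \<in> vec ` realised" if "x \<in> vec ` realised" "y \<in> vec ` realised" for x y
      proof -
        obtain g h where "g \<in> realised" "h \<in> realised" "x = vec g" "y = vec h" using \<open>x \<in> vec ` realised\<close> \<open>y \<in> vec ` realised\<close> by blast
        then show ?thesis using m_closed[of g h] unfolding Gamma_simps by (metis vec imageI)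
      qed
      show "length x = 4" if "x \<in> vec ` realised" for x using that by (auto simp: vec_def)
      show "length (vec t) = 4" by (cases t) (simp add: vec_def)
    qed (use realised_transitive \<open>vec t \<notin> vec ` realised\<close> in blast)+
    then obtain c where c: "length c = 4" "\<forall>x\<in>vec ` realised. \<not> dot2 c x" "dot2 c (vec t)" by blast
    then obtain c1 c2 c3 c4 where "c = [c1, c2, c3, c4]"
      by (auto simp: length_Suc_conv numeral_eq_Suc)
    then have "\<forall>x\<in>realised. \<not> sign_char (c1, c2, c3, c4) x" "sign_char (c1, c2, c3, c4) t"
      using c by (simp_all add: sign_char)
    then show False using t realised_moves_nonsquare by blast
  qed
  then obtain x where x: "x \<in> realised" "vec x = vec t" by force
  then have "t = x \<or> t = gamma_mult (True, False, False, False, False) x"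
    by (cases x; cases t) (auto simp: vec_def)
  then show "t \<in> realised" using x(1) m_closed[OF minus_in_realised x(1)] by auto
qed (use realised_fixes_square in blast)

end

section \<open>The Galois group as a permutation group\<close>

lemma is_square_nonneg: "is_square (q::rat) \<Longrightarrow> q \<ge> 0"
  by (auto elim: is_nth_powerE)

context biquadratic_octic
begin

lemma act_gamma_mult: "act (gamma_mult t t') x = act t (act t' x)"
proof -
  obtain z k e u v z' k' e' u' v' z'' k'' e'' where
    eq: "t = (z, k, e, u, v)" "t' = (z', k', e', u', v')" "x = (z'', k'', e'')" by (metis surj_pair)
  have "gamma_mult (gamma_mult t t') (z'', k'', e'', False, False) = gamma_mult t (gamma_mult t' (z'', k'', e'', False, False))"
    unfolding eq by (rule gamma_mult_assoc)
  then show ?thesis by (simp add: eq)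
qed

lemma act_unity: "act (False, False, False, False, False) x = x"
  by (cases x) simp

text \<open>A quintuple is determined by its effect on the roots \<open>\<alpha>\<close>, \<open>\<i> \<alpha>\<close> and \<open>r / \<alpha>\<close>.\<close>

lemma act_faithful: "(\<And>x. act t x = act t' x) \<Longrightarrow> t = t'"
proof -
  assume *: "\<And>x. act t x = act t' x"
  show "t = t'"
    using *[of "(False, False, False)"] *[of "(False, True, False)"] *[of "(False, False, True)"]
    by (cases t; cases t') auto
qed

lemma galois_group_embedding: "\<sigma> \<in> galois_group f \<Longrightarrow> embedding L \<sigma>"
  by (auto simp: galois_group_def Let_def ring_iso_def ring_hom_def embedding_def)

text \<open>The image of the splitting field contains all roots, because the action on labels is invertible; hence the embedding is onto.\<close>

lemma restrict_in_galois_group: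
  assumes "realises \<phi> t"
  shows "restrict \<phi> L \<in> galois_group f"
proof -
  interpret field_embedding L \<phi> by (rule realises_embedding[OF assms])
  interpret Gamma: group Gamma by (rule group_Gamma)
  have sub: "subfield_of_complex (\<phi> ` L)"
    unfolding subfield_of_complex_def
    by (auto intro!: image_eqI[of _ \<phi>, OF one[symmetric]] image_eqI[of _ \<phi>, OF minus[symmetric]]
       image_eqI[of _ \<phi>, OF inverse[symmetric]] image_eqI[of _ \<phi>, OF add[symmetric]] image_eqI[of _ \<phi>, OF mult[symmetric]] L_closed(1-5))
  have "root x \<in> \<phi> ` L" for x
  proof -
    have "act t (act (inv\<^bsub>Gamma\<^esub> t) x) = x"
      using act_gamma_mult[of t "inv\<^bsub>Gamma\<^esub> t" x] Gamma.r_inv[of t] by (simp add: act_unity)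
    then show ?thesis using realises_root[OF assms, of "act (inv\<^bsub>Gamma\<^esub> t) x"] root_in_L by (metis imageI)
  qed
  from this[of "(False, False, False)"] this[of "(False, True, False)"] this[of "(False, False, True)"]
  have \<alpha>: "\<alpha> \<in> \<phi> ` L" and "\<i> * \<alpha> \<in> \<phi> ` L" "r / \<alpha> \<in> \<phi> ` L" by simp_all
  then have "\<i> * \<alpha> / \<alpha> \<in> \<phi> ` L" "r / \<alpha> * \<alpha> \<in> \<phi> ` L"
    using subfield_closed(5,7)[OF sub] by blast+
  then have "L \<subseteq> \<phi> ` L" using \<alpha>_nz by (intro L_subset sub \<alpha>) simp_all
  moreover have "\<phi> ` L \<subseteq> L" using realises_in_L[OF assms] by blast
  ultimately have "bij_betw \<phi> L L" using inj by (auto simp: bij_betw_def)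
  then have "bij_betw (restrict \<phi> L) L L" by (simp cong: bij_betw_cong)
  then show ?thesis
    using of_rat_in_subfield[OF L] realises_in_L[OF assms]
    by (auto simp: galois_group_def Let_def ring_iso_def ring_hom_def L_closed(1,4,5) add mult)
qed

text \<open>Numbering the root labels turns quintuples into permutations of \<open>{1..8}\<close>. This is a faithful
  homomorphism, and the realised quintuples are carried onto the Galois group.\<close>

lemma has_galois_class_transitive8:
  assumes iso: "Gamma\<lparr>carrier := realised\<rparr> \<cong> G"
  shows "has_galois_class f (transitive8_class G)"
proof -
  interpret Gamma: group Gamma by (rule group_Gamma)
  interpret realised: subgroup realised Gamma by (rule realised_subgroup)
  have "card {1..8::nat} = card (UNIV :: (bool \<times> bool \<times> bool) set)"
    by (simp add: card_UNIV_bool flip: UNIV_Times_UNIV)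
  then obtain \<iota> where \<iota>: "bij_betw \<iota> {1..8::nat} (UNIV :: (bool \<times> bool \<times> bool) set)"
    using finite_same_card_bij[of "{1..8::nat}" "UNIV :: (bool \<times> bool \<times> bool) set"] by auto
  define \<rho> where "\<rho> j = root (\<iota> j)" for j
  define \<pi> where "\<pi> t j = (if j \<in> {1..8} then inv_into {1..8} \<iota> (act t (\<iota> j)) else j)" for t j
  have \<rho>: "bij_betw \<rho> {1..8} (complex_roots f)"
    unfolding complex_roots_eq \<rho>_def using bij_betw_trans[OF \<iota> bij_betw_imageI[OF inj_root refl]] by (simp add: comp_def)
  have \<iota>_surj: "y \<in> \<iota> ` {1..8}" for y
    by (simp only: bij_betw_imp_surj_on[OF \<iota>] UNIV_I)
  have \<pi>_in: "\<pi> t j \<in> {1..8}" and \<iota>\<pi>: "\<iota> (\<pi> t j) = act t (\<iota> j)" if "j \<in> {1..8}" for t j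
    unfolding \<pi>_def if_P[OF that] by (rule inv_into_into[OF \<iota>_surj], rule f_inv_into_f[OF \<iota>_surj])
  have \<iota>_eq: "i = j" if "i \<in> {1..8}" "j \<in> {1..8}" "\<iota> i = \<iota> j" for i j
    by (rule inj_onD[OF bij_betw_imp_inj_on[OF \<iota>] that(3,1,2)])
  have \<pi>_out: "\<pi> t j = j" if "j \<notin> {1..8}" for t j
    unfolding \<pi>_def using that by (rule if_not_P)
  have \<pi>_mult: "\<pi> (gamma_mult t t') = \<pi> t \<circ> \<pi> t'" for t t'
  proof
    fix j
    show "\<pi> (gamma_mult t t') j = (\<pi> t \<circ> \<pi> t') j"
    proof (cases "j \<in> {1..8}")
      case True
      then show ?thesis
        by (intro \<iota>_eq) (simp_all only: comp_apply \<pi>_in \<iota>\<pi> act_gamma_mult)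
    next
      case False
      then show ?thesis by (simp only: comp_apply id_apply \<pi>_out[OF False])
    qed
  qed
  have \<pi>_one: "\<pi> (False, False, False, False, False) = id"
  proof
    fix j
    show "\<pi> (False, False, False, False, False) j = id j"
    proof (cases "j \<in> {1..8}")
      case True
      then show ?thesis
        by (intro \<iota>_eq) (simp_all only: id_apply \<pi>_in \<iota>\<pi> act_unity)
    next
      case False
      then show ?thesis by (simp only: comp_apply id_apply \<pi>_out[OF False])
    qed
  qed
  have \<pi>_permutes: "\<pi> t permutes {1..8}" for t
  proof -
    have "\<pi> t \<circ> \<pi> (inv\<^bsub>Gamma\<^esub> t) = id" "\<pi> (inv\<^bsub>Gamma\<^esub> t) \<circ> \<pi> t = id"
      using Gamma.r_inv[of t] Gamma.l_inv[of t] by (simp_all add: \<pi>_one flip: \<pi>_mult)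
    then have "bij (\<pi> t)" by (intro o_bij)
    then show ?thesis unfolding permutes_def bij_iff using \<pi>_out by simp
  qed
  have hom: "\<pi> \<in> hom Gamma (sym_group 8)"
    by (rule homI) (simp_all add: sym_group_def \<pi>_permutes \<pi>_mult del: One_nat_def)
  interpret \<pi>: group_hom Gamma "sym_group 8" \<pi>
    by (intro group_hom.intro group_Gamma sym_group_is_group group_hom_axioms.intro hom)
  have inj: "inj \<pi>"
  proof (rule injI)
    fix t t' assume eq: "\<pi> t = \<pi> t'"
    show "t = t'"
    proof (rule act_faithful)
      fix x
      obtain j where "j \<in> {1..8}" "x = \<iota> j" using \<iota>_surj[of x] by (rule imageE)
      then show "act t x = act t' x" using \<iota>\<pi>[of j t] \<iota>\<pi>[of j t'] eq by simp
    qed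
  qed
  have perms: "galois_perms f \<rho> = \<pi> ` realised"
  proof (intro equalityI subsetI)
    fix p assume "p \<in> galois_perms f \<rho>"
    then obtain \<sigma> where p: "p permutes {1..8}" and \<sigma>: "\<sigma> \<in> galois_group f" "\<And>i. i \<in> {1..8} \<Longrightarrow> \<rho> (p i) = \<sigma> (\<rho> i)"
      by (auto simp: galois_perms_def)
    obtain z k e u v where t: "realises \<sigma> (z, k, e, u, v)"
      using embedding_realises[OF galois_group_embedding[OF \<sigma>(1)]] by metis
    have "p i = \<pi> (z, k, e, u, v) i" for i
    proof (cases "i \<in> {1..8}")
      case True
      have "root (\<iota> (p i)) = root (\<iota> (\<pi> (z, k, e, u, v) i))"
        using \<sigma>(2)[OF True] by (simp only: \<rho>_def realises_root[OF t] \<iota>\<pi>[OF True])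
      then have "\<iota> (p i) = \<iota> (\<pi> (z, k, e, u, v) i)" by (rule injD[OF inj_root])
      then show ?thesis using \<iota>_eq permutes_in_image[OF p] \<pi>_in[OF True] True by blast
    next
      case False
      then show ?thesis by (simp only: permutes_not_in[OF p False] \<pi>_out[OF False])
    qed
    then have "p = \<pi> (z, k, e, u, v)" by blast
    then show "p \<in> \<pi> ` realised" using t unfolding realised_def by blast
  next
    fix p assume "p \<in> \<pi> ` realised"
    then obtain t \<phi> where p: "p = \<pi> t" and t: "realises \<phi> t" by (auto simp: realised_def)
    have "\<rho> (p i) = restrict \<phi> L (\<rho> i)" if "i \<in> {1..8}" for i
      by (simp only: p \<rho>_def \<iota>\<pi>[OF that] realises_root[OF t] restrict_apply root_in_L if_True)
    then show "p \<in> galois_perms f \<rho>"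
      unfolding galois_perms_def using \<pi>_permutes restrict_in_galois_group[OF t] p by blast
  qed
  have trans: "\<exists>p\<in>\<pi> ` realised. p i = j" if "i \<in> {1..8}" "j \<in> {1..8}" for i j
  proof -
    have "\<exists>t\<in>realised. act t (False, False, False) = x" for x
    proof -
      obtain z k e where x: "x = (z, k, e)" by (metis surj_pair)
      obtain u v where "(z, k, e, u, v) \<in> realised" using realised_transitive by blast
      then show ?thesis unfolding x by (rule rev_bexI) simp
    qed
    from this[of "\<iota> i"] this[of "\<iota> j"]
    obtain t t' where t: "t \<in> realised" "act t (False, False, False) = \<iota> i"
      and t': "t' \<in> realised" "act t' (False, False, False) = \<iota> j" by blast
    have "act (inv\<^bsub>Gamma\<^esub> t) (act t (False, False, False)) = (False, False, False)"
      using act_gamma_mult[of "inv\<^bsub>Gamma\<^esub> t" t] Gamma.l_inv[of t] by (simp add: act_unity del: act.simps)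
    then have "act (gamma_mult t' (inv\<^bsub>Gamma\<^esub> t)) (\<iota> i) = \<iota> j"
      by (simp only: act_gamma_mult t(2)[symmetric]) (simp only: t'(2))
    then have "\<pi> (gamma_mult t' (inv\<^bsub>Gamma\<^esub> t)) i = j"
      using that by (intro \<iota>_eq) (simp_all only: \<pi>_in \<iota>\<pi>)
    moreover have "gamma_mult t' (inv\<^bsub>Gamma\<^esub> t) \<in> realised"
      using realised.m_closed[OF t'(1) realised.m_inv_closed[OF t(1)]] by simp
    ultimately show ?thesis by blast
  qed
  have "\<pi> \<in> iso (Gamma\<lparr>carrier := realised\<rparr>) ((sym_group 8)\<lparr>carrier := \<pi> ` realised\<rparr>)"
    using inj_on_subset[OF inj] by (auto simp: iso_def hom_def bij_betw_def \<pi>_mult sym_group_def)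
  then have "(sym_group 8)\<lparr>carrier := \<pi> ` realised\<rparr> \<cong> Gamma\<lparr>carrier := realised\<rparr>"
    using group.iso_sym[OF Gamma.subgroup_imp_group[OF realised_subgroup]] is_isoI by blast
  then have "(sym_group 8)\<lparr>carrier := \<pi> ` realised\<rparr> \<cong> G"
    using iso iso_trans by blast
  then have "\<pi> ` realised \<in> transitive8_class G"
    unfolding transitive8_class_def using \<pi>.subgroup_img_is_subgroup[OF realised_subgroup] trans by blast
  then show ?thesis unfolding has_galois_class_def using \<rho> perms by metis
qed

end

section \<open>Multiplicative relations between the radicands\<close>

context biquadratic_octic
begin

text \<open>The first two numbers are negative. The other three are the radicands of characters that depend
  only on \<open>k\<close> and \<open>e\<close>, and by transitivity no nontrivial character of this kind vanishes on all realised symmetries.\<close>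

lemma radicand_nonsquare:
  "\<not> is_square (- 1 :: rat)" "\<not> is_square (- s)" "\<not> is_square (2 * s - a)" "\<not> is_square (- (a + 2 * s))"
  "\<not> is_square (a\<^sup>2 - 4 * s\<^sup>2)"
proof -
  show "\<not> is_square (- 1 :: rat)" "\<not> is_square (- s)" using is_square_nonneg s_pos by fastforce+
  obtain u v where t: "(False, True, False, u, v) \<in> realised" using realised_transitive by blast
  obtain u' v' where t': "(False, False, True, u', v') \<in> realised" using realised_transitive by blast
  show "\<not> is_square (2 * s - a)"
    using realised_fixes_square[OF _ t, of "(False, False, True, False)"] by (auto simp: radicand_def sign_char_def)
  show "\<not> is_square (- (a + 2 * s))"
    using realised_fixes_square[OF _ t, of "(False, False, False, True)"] by (auto simp: radicand_def sign_char_def)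
  show "\<not> is_square (a\<^sup>2 - 4 * s\<^sup>2)"
    using realised_fixes_square[OF _ t', of "(False, False, True, True)"]
    by (auto simp: radicand_def sign_char_def algebra_simps power2_eq_square)
qed

lemma radicand_values:
  "radicand (False, False, False, False) = 1"
  "radicand (True, False, False, False) = - 1"
  "radicand (False, True, False, False) = s"
  "radicand (True, True, False, False) = - s"
  "radicand (False, False, True, False) = 2 * s - a"
  "radicand (True, False, True, False) = a - 2 * s"
  "radicand (False, False, False, True) = - (a + 2 * s)"
  "radicand (True, False, False, True) = a + 2 * s"
  "radicand (False, False, True, True) = a\<^sup>2 - 4 * s\<^sup>2"
  "radicand (True, False, True, True) = 4 * s\<^sup>2 - a\<^sup>2"
  "radicand (False, True, True, False) = 2 * s\<^sup>2 - a * s"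
  "radicand (True, True, True, False) = - (2 * s\<^sup>2 - a * s)"
  "radicand (True, True, False, True) = 2 * s\<^sup>2 + a * s"
  "radicand (False, True, False, True) = - (2 * s\<^sup>2 + a * s)"
  "radicand (False, True, True, True) = s * (a\<^sup>2 - 4 * s\<^sup>2)"
  "radicand (True, True, True, True) = s * (4 * s\<^sup>2 - a\<^sup>2)"
  by (simp_all add: radicand_def algebra_simps power2_eq_square)

text \<open>Five of the fifteen nontrivial characters drop out because their radicands are never squares.\<close>

lemma realised_relations:
  "realised = {(z, k, e, u, v). (is_square s \<longrightarrow> \<not> v) \<and> (is_square (a - 2 * s) \<longrightarrow> u = k) \<and>
     (is_square (a + 2 * s) \<longrightarrow> u = (k \<noteq> e)) \<and> (is_square (4 * s\<^sup>2 - a\<^sup>2) \<longrightarrow> u = e) \<and>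
     (is_square (2 * s\<^sup>2 - a * s) \<longrightarrow> v = k) \<and> (is_square (- (2 * s\<^sup>2 - a * s)) \<longrightarrow> (u \<noteq> v) = k) \<and>
     (is_square (2 * s\<^sup>2 + a * s) \<longrightarrow> (u \<noteq> v) = (k \<noteq> e)) \<and> (is_square (- (2 * s\<^sup>2 + a * s)) \<longrightarrow> v = (k \<noteq> e)) \<and>
     (is_square (s * (a\<^sup>2 - 4 * s\<^sup>2)) \<longrightarrow> v = e) \<and> (is_square (s * (4 * s\<^sup>2 - a\<^sup>2)) \<longrightarrow> (u \<noteq> v) = e)}"
  (is "realised = ?R")
proof (rule Set.set_eqI)
  fix t :: symmetry
  obtain z k e u v where t: "t = (z, k, e, u, v)" by (metis surj_pair)
  have "t \<in> realised \<longleftrightarrow> (\<forall>c. is_square (radicand c) \<longrightarrow> \<not> sign_char c t)"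
    by (subst realised_eq) (rule mem_Collect_eq)
  then show "t \<in> realised \<longleftrightarrow> t \<in> ?R"
    unfolding t mem_Collect_eq prod.case split_paired_All all_bool_eq sign_char_def radicand_values
    using radicand_nonsquare by (cases k; cases e; cases u; cases v) (simp only: simp_thms; blast)+
qed

text \<open>The Galois action replaces a computation with square classes: a symmetry that changes the sign of the product of two radicals changes the sign of one of them.\<close>

lemma radicand_add:
  assumes "is_square (radicand (c1, c2, c3, c4))" "is_square (radicand (d1, d2, d3, d4))"
  shows "is_square (radicand (c1 \<noteq> d1, c2 \<noteq> d2, c3 \<noteq> d3, c4 \<noteq> d4))"
proof (rule ccontr)
  assume "\<not> ?thesis"
  then obtain t where t: "t \<in> realised" "sign_char (c1 \<noteq> d1, c2 \<noteq> d2, c3 \<noteq> d3, c4 \<noteq> d4) t"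
    using realised_moves_nonsquare by blast
  have "sign_char (c1, c2, c3, c4) t \<or> sign_char (d1, d2, d3, d4) t"
    using t(2) by (cases t) (auto simp: sign_char_def)
  then show False using realised_fixes_square assms t(1) by blast
qed

text \<open>In each pair the product is, up to a rational square, one of the five numbers that are never squares.\<close>

lemma incompatible_squares:
  "\<not> (is_square s \<and> is_square (2 * s\<^sup>2 - a * s))"
  "\<not> (is_square s \<and> is_square (- (2 * s\<^sup>2 + a * s)))"
  "\<not> (is_square s \<and> is_square (s * (a\<^sup>2 - 4 * s\<^sup>2)))"
  "\<not> (is_square (a - 2 * s) \<and> is_square (a + 2 * s))"
  "\<not> (is_square (a - 2 * s) \<and> is_square (4 * s\<^sup>2 - a\<^sup>2))"
  "\<not> (is_square (a - 2 * s) \<and> is_square (2 * s\<^sup>2 - a * s))"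
  "\<not> (is_square (a + 2 * s) \<and> is_square (4 * s\<^sup>2 - a\<^sup>2))"
  "\<not> (is_square (a + 2 * s) \<and> is_square (- (2 * s\<^sup>2 + a * s)))"
  "\<not> (is_square (4 * s\<^sup>2 - a\<^sup>2) \<and> is_square (s * (a\<^sup>2 - 4 * s\<^sup>2)))"
  "\<not> (is_square (2 * s\<^sup>2 - a * s) \<and> is_square (- (2 * s\<^sup>2 + a * s)))"
  "\<not> (is_square (2 * s\<^sup>2 - a * s) \<and> is_square (s * (a\<^sup>2 - 4 * s\<^sup>2)))"
  "\<not> (is_square (2 * s\<^sup>2 - a * s) \<and> is_square (- (2 * s\<^sup>2 - a * s)))"
  "\<not> (is_square (- (2 * s\<^sup>2 + a * s)) \<and> is_square (s * (a\<^sup>2 - 4 * s\<^sup>2)))"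
  "\<not> (is_square (- (2 * s\<^sup>2 + a * s)) \<and> is_square (2 * s\<^sup>2 + a * s))"
  "\<not> (is_square (s * (a\<^sup>2 - 4 * s\<^sup>2)) \<and> is_square (s * (4 * s\<^sup>2 - a\<^sup>2)))"
  "\<not> (is_square (- (2 * s\<^sup>2 - a * s)) \<and> is_square (2 * s\<^sup>2 + a * s))"
  "\<not> (is_square (- (2 * s\<^sup>2 - a * s)) \<and> is_square (s * (4 * s\<^sup>2 - a\<^sup>2)))"
  "\<not> (is_square (2 * s\<^sup>2 + a * s) \<and> is_square (s * (4 * s\<^sup>2 - a\<^sup>2)))"
  subgoal using radicand_nonsquare radicand_add[of False True False False False True True False] by (auto simp: radicand_values)
  subgoal using radicand_nonsquare radicand_add[of False True False False False True False True] by (auto simp: radicand_values)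
  subgoal using radicand_nonsquare radicand_add[of False True False False False True True True] by (auto simp: radicand_values)
  subgoal using radicand_nonsquare radicand_add[of True False True False True False False True] by (auto simp: radicand_values)
  subgoal using radicand_nonsquare radicand_add[of True False True False True False True True] by (auto simp: radicand_values)
  subgoal using radicand_nonsquare radicand_add[of True False True False False True True False] by (auto simp: radicand_values)
  subgoal using radicand_nonsquare radicand_add[of True False False True True False True True] by (auto simp: radicand_values)
  subgoal using radicand_nonsquare radicand_add[of True False False True False True False True] by (auto simp: radicand_values)
  subgoal using radicand_nonsquare radicand_add[of True False True True False True True True] by (auto simp: radicand_values)
  subgoal using radicand_nonsquare radicand_add[of False True True False False True False True] by (auto simp: radicand_values)
  subgoal using radicand_nonsquare radicand_add[of False True True False False True True True] by (auto simp: radicand_values)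
  subgoal using radicand_nonsquare radicand_add[of False True True False True True True False] by (auto simp: radicand_values)
  subgoal using radicand_nonsquare radicand_add[of False True False True False True True True] by (auto simp: radicand_values)
  subgoal using radicand_nonsquare radicand_add[of False True False True True True False True] by (auto simp: radicand_values)
  subgoal using radicand_nonsquare radicand_add[of False True True True True True True True] by (auto simp: radicand_values)
  subgoal using radicand_nonsquare radicand_add[of True True True False True True False True] by (auto simp: radicand_values)
  subgoal using radicand_nonsquare radicand_add[of True True True False True True True True] by (auto simp: radicand_values)
  subgoal using radicand_nonsquare radicand_add[of True True False True True True True True] by (auto simp: radicand_values)
  done

text \<open>In each triple the product of all three numbers is a square, so two squares force the third.\<close>

lemma dependent_squares:
  "(is_square s \<and> is_square (a - 2 * s) \<longrightarrow> is_square (- (2 * s\<^sup>2 - a * s))) \<and> (is_square s \<and> is_square (- (2 * s\<^sup>2 - a * s)) \<longrightarrow> is_square (a - 2 * s)) \<and> (is_square (a - 2 * s) \<and> is_square (- (2 * s\<^sup>2 - a * s)) \<longrightarrow> is_square s)"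
  "(is_square s \<and> is_square (a + 2 * s) \<longrightarrow> is_square (2 * s\<^sup>2 + a * s)) \<and> (is_square s \<and> is_square (2 * s\<^sup>2 + a * s) \<longrightarrow> is_square (a + 2 * s)) \<and> (is_square (a + 2 * s) \<and> is_square (2 * s\<^sup>2 + a * s) \<longrightarrow> is_square s)"
  "(is_square s \<and> is_square (4 * s\<^sup>2 - a\<^sup>2) \<longrightarrow> is_square (s * (4 * s\<^sup>2 - a\<^sup>2))) \<and> (is_square s \<and> is_square (s * (4 * s\<^sup>2 - a\<^sup>2)) \<longrightarrow> is_square (4 * s\<^sup>2 - a\<^sup>2)) \<and> (is_square (4 * s\<^sup>2 - a\<^sup>2) \<and> is_square (s * (4 * s\<^sup>2 - a\<^sup>2)) \<longrightarrow> is_square s)"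
  "(is_square (a - 2 * s) \<and> is_square (- (2 * s\<^sup>2 + a * s)) \<longrightarrow> is_square (s * (4 * s\<^sup>2 - a\<^sup>2))) \<and> (is_square (a - 2 * s) \<and> is_square (s * (4 * s\<^sup>2 - a\<^sup>2)) \<longrightarrow> is_square (- (2 * s\<^sup>2 + a * s))) \<and> (is_square (- (2 * s\<^sup>2 + a * s)) \<and> is_square (s * (4 * s\<^sup>2 - a\<^sup>2)) \<longrightarrow> is_square (a - 2 * s))"
  "(is_square (a - 2 * s) \<and> is_square (s * (a\<^sup>2 - 4 * s\<^sup>2)) \<longrightarrow> is_square (2 * s\<^sup>2 + a * s)) \<and> (is_square (a - 2 * s) \<and> is_square (2 * s\<^sup>2 + a * s) \<longrightarrow> is_square (s * (a\<^sup>2 - 4 * s\<^sup>2))) \<and> (is_square (s * (a\<^sup>2 - 4 * s\<^sup>2)) \<and> is_square (2 * s\<^sup>2 + a * s) \<longrightarrow> is_square (a - 2 * s))"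
  "(is_square (a + 2 * s) \<and> is_square (2 * s\<^sup>2 - a * s) \<longrightarrow> is_square (s * (4 * s\<^sup>2 - a\<^sup>2))) \<and> (is_square (a + 2 * s) \<and> is_square (s * (4 * s\<^sup>2 - a\<^sup>2)) \<longrightarrow> is_square (2 * s\<^sup>2 - a * s)) \<and> (is_square (2 * s\<^sup>2 - a * s) \<and> is_square (s * (4 * s\<^sup>2 - a\<^sup>2)) \<longrightarrow> is_square (a + 2 * s))"
  "(is_square (a + 2 * s) \<and> is_square (s * (a\<^sup>2 - 4 * s\<^sup>2)) \<longrightarrow> is_square (- (2 * s\<^sup>2 - a * s))) \<and> (is_square (a + 2 * s) \<and> is_square (- (2 * s\<^sup>2 - a * s)) \<longrightarrow> is_square (s * (a\<^sup>2 - 4 * s\<^sup>2))) \<and> (is_square (s * (a\<^sup>2 - 4 * s\<^sup>2)) \<and> is_square (- (2 * s\<^sup>2 - a * s)) \<longrightarrow> is_square (a + 2 * s))"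
  "(is_square (4 * s\<^sup>2 - a\<^sup>2) \<and> is_square (2 * s\<^sup>2 - a * s) \<longrightarrow> is_square (2 * s\<^sup>2 + a * s)) \<and> (is_square (4 * s\<^sup>2 - a\<^sup>2) \<and> is_square (2 * s\<^sup>2 + a * s) \<longrightarrow> is_square (2 * s\<^sup>2 - a * s)) \<and> (is_square (2 * s\<^sup>2 - a * s) \<and> is_square (2 * s\<^sup>2 + a * s) \<longrightarrow> is_square (4 * s\<^sup>2 - a\<^sup>2))"
  "(is_square (4 * s\<^sup>2 - a\<^sup>2) \<and> is_square (- (2 * s\<^sup>2 + a * s)) \<longrightarrow> is_square (- (2 * s\<^sup>2 - a * s))) \<and> (is_square (4 * s\<^sup>2 - a\<^sup>2) \<and> is_square (- (2 * s\<^sup>2 - a * s)) \<longrightarrow> is_square (- (2 * s\<^sup>2 + a * s))) \<and> (is_square (- (2 * s\<^sup>2 + a * s)) \<and> is_square (- (2 * s\<^sup>2 - a * s)) \<longrightarrow> is_square (4 * s\<^sup>2 - a\<^sup>2))"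
  subgoal using radicand_add[of False True False False True False True False] radicand_add[of False True False False True True True False] radicand_add[of True False True False True True True False] by (auto simp: radicand_values)
  subgoal using radicand_add[of False True False False True False False True] radicand_add[of False True False False True True False True] radicand_add[of True False False True True True False True] by (auto simp: radicand_values)
  subgoal using radicand_add[of False True False False True False True True] radicand_add[of False True False False True True True True] radicand_add[of True False True True True True True True] by (auto simp: radicand_values)
  subgoal using radicand_add[of True False True False False True False True] radicand_add[of True False True False True True True True] radicand_add[of False True False True True True True True] by (auto simp: radicand_values)
  subgoal using radicand_add[of True False True False False True True True] radicand_add[of True False True False True True False True] radicand_add[of False True True True True True False True] by (auto simp: radicand_values)
  subgoal using radicand_add[of True False False True False True True False] radicand_add[of True False False True True True True True] radicand_add[of False True True False True True True True] by (auto simp: radicand_values)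
  subgoal using radicand_add[of True False False True False True True True] radicand_add[of True False False True True True True False] radicand_add[of False True True True True True True False] by (auto simp: radicand_values)
  subgoal using radicand_add[of True False True True False True True False] radicand_add[of True False True True True True False True] radicand_add[of False True True False True True False True] by (auto simp: radicand_values)
  subgoal using radicand_add[of True False True True False True False True] radicand_add[of True False True True True True True False] radicand_add[of False True False True True True True False] by (auto simp: radicand_values)
  done

end

section \<open>The classification\<close>

context biquadratic_octic
begin

text \<open>Either number may be a square on its own, but their sum is the negative number \<open>- 4 s\<^sup>2\<close>. If both
  were squares, the Galois group would have order 8 in a case whose answer is a group of order 16.\<close>

lemma sign_obstruction:
  "\<not> (is_square (- (2 * s\<^sup>2 - a * s)) \<and> is_square (- (2 * s\<^sup>2 + a * s)))"
proof
  assume "is_square (- (2 * s\<^sup>2 - a * s)) \<and> is_square (- (2 * s\<^sup>2 + a * s))"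
  then have "0 \<le> - (2 * s\<^sup>2 - a * s) + - (2 * s\<^sup>2 + a * s)"
    using is_square_nonneg by (intro add_nonneg_nonneg) blast+
  then have "s\<^sup>2 \<le> 0" by simp
  then show False using s_pos by simp
qed

lemma realised_eqI:
  assumes "\<And>k e u v. (is_square s \<longrightarrow> \<not> v) \<and> (is_square (a - 2 * s) \<longrightarrow> u = k) \<and>
     (is_square (a + 2 * s) \<longrightarrow> u = (k \<noteq> e)) \<and> (is_square (4 * s\<^sup>2 - a\<^sup>2) \<longrightarrow> u = e) \<and>
     (is_square (2 * s\<^sup>2 - a * s) \<longrightarrow> v = k) \<and> (is_square (- (2 * s\<^sup>2 - a * s)) \<longrightarrow> (u \<noteq> v) = k) \<and>
     (is_square (2 * s\<^sup>2 + a * s) \<longrightarrow> (u \<noteq> v) = (k \<noteq> e)) \<and> (is_square (- (2 * s\<^sup>2 + a * s)) \<longrightarrow> v = (k \<noteq> e)) \<and>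
     (is_square (s * (a\<^sup>2 - 4 * s\<^sup>2)) \<longrightarrow> v = e) \<and> (is_square (s * (4 * s\<^sup>2 - a\<^sup>2)) \<longrightarrow> (u \<noteq> v) = e) \<longleftrightarrow> P k e u v"
  shows "realised = {(z, k, e, u, v). P k e u v}"
  by (subst realised_relations) (simp only: assms)

lemmas square_relations = incompatible_squares dependent_squares sign_obstruction

text \<open>Each configuration of square radicands is completed by the preceding relations, which leaves at most two
  independent characters; their common kernel is one of the nineteen subgroups identified above.\<close>

lemma galois_class_8_2:
  "is_square s \<Longrightarrow> is_square (4 * s\<^sup>2 - a\<^sup>2) \<Longrightarrow> \<not> is_square (a + 2 * s) \<Longrightarrow> \<not> is_square (a - 2 * s) \<Longrightarrow>
    has_galois_class f T8_2"
  "is_square (a + 2 * s) \<Longrightarrow> is_square (- (2 * s\<^sup>2 - a * s)) \<Longrightarrow> \<not> is_square s \<Longrightarrow> \<not> is_square (2 * s\<^sup>2 - a * s) \<Longrightarrow>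
    has_galois_class f T8_2"
  "is_square (a - 2 * s) \<Longrightarrow> is_square (- (2 * s\<^sup>2 + a * s)) \<Longrightarrow> \<not> is_square s \<Longrightarrow> \<not> is_square (a + 2 * s) \<Longrightarrow> \<not> is_square (2 * s\<^sup>2 + a * s) \<Longrightarrow>
    has_galois_class f T8_2"
  unfolding T8_2_def
  subgoal by (intro has_galois_class_transitive8 subgroup_iso_C4_C2(1) realised_subgroup realised_eqI)
    (use square_relations in satx)
  subgoal by (intro has_galois_class_transitive8 subgroup_iso_C4_C2(2) realised_subgroup realised_eqI)
    (use square_relations in satx)
  subgoal by (intro has_galois_class_transitive8 subgroup_iso_C4_C2(3) realised_subgroup realised_eqI)
    (use square_relations in satx)
  done

lemma galois_class_8_3:
  "is_square s \<Longrightarrow> is_square (a + 2 * s) \<Longrightarrow>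
    has_galois_class f T8_3"
  unfolding T8_3_def
  subgoal by (intro has_galois_class_transitive8 subgroup_iso_C2_C2_C2(1) realised_subgroup realised_eqI)
    (use square_relations in satx)
  done

lemma galois_class_8_4:
  "is_square s \<Longrightarrow> is_square (a - 2 * s) \<Longrightarrow> \<not> is_square (a + 2 * s) \<Longrightarrow>
    has_galois_class f T8_4"
  "is_square (a + 2 * s) \<Longrightarrow> is_square (2 * s\<^sup>2 - a * s) \<Longrightarrow> \<not> is_square s \<Longrightarrow>
    has_galois_class f T8_4"
  "is_square (a - 2 * s) \<Longrightarrow> is_square (2 * s\<^sup>2 + a * s) \<Longrightarrow> \<not> is_square s \<Longrightarrow> \<not> is_square (a + 2 * s) \<Longrightarrow>
    has_galois_class f T8_4"
  "is_square (2 * s\<^sup>2 - a * s) \<Longrightarrow> is_square (2 * s\<^sup>2 + a * s) \<Longrightarrow> \<not> is_square s \<Longrightarrow> \<not> is_square (a + 2 * s) \<Longrightarrow> \<not> is_square (a - 2 * s) \<Longrightarrow>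
    has_galois_class f T8_4"
  unfolding T8_4_def
  subgoal by (intro has_galois_class_transitive8 subgroup_iso_D4(1) realised_subgroup realised_eqI)
    (use square_relations in satx)
  subgoal by (intro has_galois_class_transitive8 subgroup_iso_D4(2) realised_subgroup realised_eqI)
    (use square_relations in satx)
  subgoal by (intro has_galois_class_transitive8 subgroup_iso_D4(3) realised_subgroup realised_eqI)
    (use square_relations in satx)
  subgoal by (intro has_galois_class_transitive8 subgroup_iso_D4(4) realised_subgroup realised_eqI)
    (use square_relations in satx)
  done

lemma galois_class_8_9:
  "is_square s \<Longrightarrow> \<not> is_square (a + 2 * s) \<Longrightarrow> \<not> is_square (a - 2 * s) \<Longrightarrow> \<not> is_square (4 * s\<^sup>2 - a\<^sup>2) \<Longrightarrow>
    has_galois_class f T8_9"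
  "is_square (a + 2 * s) \<Longrightarrow> \<not> is_square s \<Longrightarrow> \<not> is_square (2 * s\<^sup>2 - a * s) \<Longrightarrow> \<not> is_square (- (2 * s\<^sup>2 - a * s)) \<Longrightarrow>
    has_galois_class f T8_9"
  "is_square (a - 2 * s) \<Longrightarrow> \<not> is_square s \<Longrightarrow> \<not> is_square (a + 2 * s) \<Longrightarrow> \<not> is_square (2 * s\<^sup>2 + a * s) \<Longrightarrow> \<not> is_square (- (2 * s\<^sup>2 + a * s)) \<Longrightarrow>
    has_galois_class f T8_9"
  "is_square (2 * s\<^sup>2 - a * s) \<Longrightarrow> \<not> is_square s \<Longrightarrow> \<not> is_square (a + 2 * s) \<Longrightarrow> \<not> is_square (a - 2 * s) \<Longrightarrow> \<not> is_square (2 * s\<^sup>2 + a * s) \<Longrightarrow>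
    has_galois_class f T8_9"
  "is_square (2 * s\<^sup>2 + a * s) \<Longrightarrow> \<not> is_square s \<Longrightarrow> \<not> is_square (a + 2 * s) \<Longrightarrow> \<not> is_square (a - 2 * s) \<Longrightarrow> \<not> is_square (2 * s\<^sup>2 - a * s) \<Longrightarrow>
    has_galois_class f T8_9"
  unfolding T8_9_def
  subgoal by (intro has_galois_class_transitive8 subgroup_iso_C2_D4(1) realised_subgroup realised_eqI)
    (use square_relations in satx)
  subgoal by (intro has_galois_class_transitive8 subgroup_iso_C2_D4(2) realised_subgroup realised_eqI)
    (use square_relations in satx)
  subgoal by (intro has_galois_class_transitive8 subgroup_iso_C2_D4(3) realised_subgroup realised_eqI)
    (use square_relations in satx)
  subgoal by (intro has_galois_class_transitive8 subgroup_iso_C2_D4(4) realised_subgroup realised_eqI)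
    (use square_relations in satx)
  subgoal by (intro has_galois_class_transitive8 subgroup_iso_C2_D4(5) realised_subgroup realised_eqI)
    (use square_relations in satx)
  done

lemma galois_class_8_11:
  "is_square (4 * s\<^sup>2 - a\<^sup>2) \<Longrightarrow> \<not> is_square s \<Longrightarrow> \<not> is_square (a + 2 * s) \<Longrightarrow> \<not> is_square (a - 2 * s) \<Longrightarrow> \<not> is_square (2 * s\<^sup>2 - a * s) \<Longrightarrow> \<not> is_square (2 * s\<^sup>2 + a * s) \<Longrightarrow>
    has_galois_class f T8_11"
  "is_square (s * (a\<^sup>2 - 4 * s\<^sup>2)) \<Longrightarrow> \<not> is_square s \<Longrightarrow> \<not> is_square (a + 2 * s) \<Longrightarrow> \<not> is_square (a - 2 * s) \<Longrightarrow> \<not> is_square (2 * s\<^sup>2 - a * s) \<Longrightarrow> \<not> is_square (2 * s\<^sup>2 + a * s) \<Longrightarrow>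
    has_galois_class f T8_11"
  "is_square (s * (4 * s\<^sup>2 - a\<^sup>2)) \<Longrightarrow> \<not> is_square s \<Longrightarrow> \<not> is_square (a + 2 * s) \<Longrightarrow> \<not> is_square (a - 2 * s) \<Longrightarrow> \<not> is_square (2 * s\<^sup>2 - a * s) \<Longrightarrow> \<not> is_square (2 * s\<^sup>2 + a * s) \<Longrightarrow>
    has_galois_class f T8_11"
  "is_square (- (2 * s\<^sup>2 - a * s)) \<Longrightarrow> \<not> is_square s \<Longrightarrow> \<not> is_square (a + 2 * s) \<Longrightarrow> \<not> is_square (a - 2 * s) \<Longrightarrow> \<not> is_square (2 * s\<^sup>2 - a * s) \<Longrightarrow> \<not> is_square (2 * s\<^sup>2 + a * s) \<Longrightarrow>
    has_galois_class f T8_11"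
  "is_square (- (2 * s\<^sup>2 + a * s)) \<Longrightarrow> \<not> is_square s \<Longrightarrow> \<not> is_square (a + 2 * s) \<Longrightarrow> \<not> is_square (a - 2 * s) \<Longrightarrow> \<not> is_square (2 * s\<^sup>2 - a * s) \<Longrightarrow> \<not> is_square (2 * s\<^sup>2 + a * s) \<Longrightarrow>
    has_galois_class f T8_11"
  unfolding T8_11_def
  subgoal by (intro has_galois_class_transitive8 subgroup_iso_C4_central_D4(1) realised_subgroup realised_eqI)
    (use square_relations in satx)
  subgoal by (intro has_galois_class_transitive8 subgroup_iso_C4_central_D4(2) realised_subgroup realised_eqI)
    (use square_relations in satx)
  subgoal by (intro has_galois_class_transitive8 subgroup_iso_C4_central_D4(3) realised_subgroup realised_eqI)
    (use square_relations in satx)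
  subgoal by (intro has_galois_class_transitive8 subgroup_iso_C4_central_D4(4) realised_subgroup realised_eqI)
    (use square_relations in satx)
  subgoal by (intro has_galois_class_transitive8 subgroup_iso_C4_central_D4(5) realised_subgroup realised_eqI)
    (use square_relations in satx)
  done

lemma galois_class_8_22:
  "\<not> is_square s \<Longrightarrow> \<not> is_square (a + 2 * s) \<Longrightarrow> \<not> is_square (a - 2 * s) \<Longrightarrow> \<not> is_square (2 * s\<^sup>2 - a * s) \<Longrightarrow> \<not> is_square (2 * s\<^sup>2 + a * s) \<Longrightarrow>
    \<not> is_square (4 * s\<^sup>2 - a\<^sup>2) \<Longrightarrow> \<not> is_square (s * (a\<^sup>2 - 4 * s\<^sup>2)) \<Longrightarrow> \<not> is_square (s * (4 * s\<^sup>2 - a\<^sup>2)) \<Longrightarrow> \<not> is_square (- (2 * s\<^sup>2 - a * s)) \<Longrightarrow> \<not> is_square (- (2 * s\<^sup>2 + a * s)) \<Longrightarrow>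
    has_galois_class f T8_22"
  unfolding T8_22_def
  subgoal by (intro has_galois_class_transitive8 subgroup_iso_D4_central_D4 realised_subgroup realised_eqI)
    (use square_relations in satx)
  done

lemma galois_class:
  "has_galois_class f
     (if is_square s then
        (if is_square (a + 2 * s) then T8_3
         else if is_square (a - 2 * s) then T8_4
         else if is_square (4 * s\<^sup>2 - a\<^sup>2) then T8_2
         else T8_9)
      else
        (if is_square (a + 2 * s) then
           (if is_square (2 * s\<^sup>2 - a * s) then T8_4
            else if is_square (- (2 * s\<^sup>2 - a * s)) then T8_2
            else T8_9)
         else if is_square (a - 2 * s) then
           (if is_square (2 * s\<^sup>2 + a * s) then T8_4
            else if is_square (- (2 * s\<^sup>2 + a * s)) then T8_2
            else T8_9)
         else
           (if is_square (2 * s\<^sup>2 - a * s) \<and> is_square (2 * s\<^sup>2 + a * s) then T8_4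
            else if is_square (2 * s\<^sup>2 - a * s) \<or> is_square (2 * s\<^sup>2 + a * s) then T8_9
            else if is_square (4 * s\<^sup>2 - a\<^sup>2) \<or> is_square (s * (a\<^sup>2 - 4 * s\<^sup>2)) \<or>
                    is_square (s * (4 * s\<^sup>2 - a\<^sup>2)) \<or>
                    is_square (- (2 * s\<^sup>2 - a * s)) \<or> is_square (- (2 * s\<^sup>2 + a * s)) then T8_11
            else T8_22)))"
proof -
  have if_I: "has_galois_class f (if c then T else U)"
    if "c \<Longrightarrow> has_galois_class f T" "\<not> c \<Longrightarrow> has_galois_class f U" for c T U
    using that by simp
  show ?thesis
    by (intro if_I) (use galois_class_8_2 galois_class_8_3 galois_class_8_4 galois_class_8_9
      galois_class_8_11 galois_class_8_22 in satx)+
qed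

end

theorem theorem3p8:
  fixes a b :: rat and f :: "rat poly"
  assumes "is_square b"
    and "f = Polynomial.monom 1 8 + Polynomial.monom a 4 + [:b:]"
    and "Factorial_Ring.irreducible f"
  shows "let s = rat_sqrt b in
    has_galois_class f
     (if is_square s then
        (if is_square (a + 2 * s) then T8_3
         else if is_square (a - 2 * s) then T8_4
         else if is_square (4 * b - a\<^sup>2) then T8_2
         else T8_9)
      else
        (if is_square (a + 2 * s) then
           (if is_square (2 * b - a * s) then T8_4
            else if is_square (- (2 * b - a * s)) then T8_2
            else T8_9)
         else if is_square (a - 2 * s) then
           (if is_square (2 * b + a * s) then T8_4
            else if is_square (- (2 * b + a * s)) then T8_2
            else T8_9)
         else
           (if is_square (2 * b - a * s) \<and> is_square (2 * b + a * s) then T8_4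
            else if is_square (2 * b - a * s) \<or> is_square (2 * b + a * s) then T8_9
            else if is_square (4 * b - a\<^sup>2) \<or> is_square (s * (a\<^sup>2 - 4 * b)) \<or>
                    is_square (s * (4 * b - a\<^sup>2)) \<or>
                    is_square (- (2 * b - a * s)) \<or> is_square (- (2 * b + a * s)) then T8_11
            else T8_22)))"
proof -
  obtain s where s: "rat_sqrt b = s" "0 \<le> s" "b = s\<^sup>2" 
    by (rule that[of "rat_sqrt b"]) (simp_all add: rat_sqrt[OF assms(1)])
  have "coeff (map_poly of_rat f :: complex poly) 8 = 1"
    by (simp add: assms(2) coeff_map_poly coeff_pCons')
  then have "8 \<le> degree (map_poly of_rat f :: complex poly)"
    by (intro le_degree) simp
  then obtain \<alpha> where \<alpha>: "eval_rat f \<alpha> = 0"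
    using fundamental_theorem_of_algebra[of "map_poly of_rat f"] by (simp add: constant_degree) blast
  interpret biquadratic_octic a s f \<alpha> "csqrt (of_rat s)"
    using assms(2,3) s \<alpha> by unfold_locales simp_all
  show ?thesis
    unfolding Let_def s(1) unfolding s(3) by (rule galois_class)
qed

end
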